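(* Let $H$ be a subgroup of $G$ and let $(K,\Psi)\in \mathcal{X}(H)$. Then $$\mathrm{ind}_H^G(e_{(K,\Psi)}^H) = \frac{|N_G(K,\Psi)|}{|N_H(K,\Psi)|}\cdot e_{(K,\Psi)}^G.$$
   Context: $A$ is a multiplicatively written abelian group; for a finite group $H$, $H^*:=\mathrm{Hom}(H,A)$ with pointwise multiplication. $G$ is a finite group such that $S^*$ is finite for all subquotients $S$ of $G$, and $\mathbb{K}$ is a field of characteristic $0$ which is a splitting field of $S^*$ for all subquotients $S$ of $G$. For a finite group $S$, $[U,\phi]_S$ denotes the $S$-conjugacy class of a pair $(U,\phi)$ with $U\le S$, $\phi\in U^*$, where ${}^g(U,\phi)=({}^gU,{}^g\phi)$, ${}^gU=gUg^{-1}$, $({}^g\phi)(x)=\phi(g^{-1}xg)$. $B^A_{\mathbb{K}}(S)$ is the $\mathbb{K}$-vector space with basis these classes and multiplication $[U,\phi]_S\cdot[V,\psi]_S=\sum_{g\in[U\backslash S/V]}[U\cap{}^gV,\phi|_{U\cap{}^gV}\cdot({}^g\psi)|_{U\cap{}^gV}]_S$. $\mathcal{X}(S)$ is the set of pairs $(H,\Phi)$ with $H\le S$, $\Phi\in\mathrm{Hom}(H^*,\mathbb{K}^\times)$, with $S$-action ${}^g(H,\Phi)=({}^gH,{}^g\Phi)$, ${}^g\Phi(\phi)=\Phi({}^{g^{-1}}\phi)$; $N_S(H,\Phi)$ is the stabilizer of $(H,\Phi)$ in $S$. $s^S_{(H,\Phi)}:=s^H_\Phi\circ\pi_H\circ\mathrm{res}^S_H\colon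 B^A_{\mathbb{K}}(S)\to\mathbb{K}$, where $\mathrm{res}^S_H([U,\phi]_S)=\sum_{g\in[H\backslash S/U]}[H\cap{}^gU,({}^g\phi)|_{H\cap{}^gU}]_H$, $\pi_H([U,\phi]_H)=\phi\in\mathbb{K}H^*$ if $U=H$ and $0$ otherwise, $s^H_\Phi\colon\mathbb{K}H^*\to\mathbb{K}$ the linear extension of $\Phi$. $e^S_{(H,\Phi)}\in B^A_{\mathbb{K}}(S)$ is the unique (primitive) idempotent with $s^S_{(K,\Psi)}(e^S_{(H,\Phi)})=1$ if $(K,\Psi)$ is $S$-conjugate to $(H,\Phi)$ and $0$ otherwise. Induction $\mathrm{ind}_H^G\colon B^A_{\mathbb{K}}(H)\to B^A_{\mathbb{K}}(G)$ is the linear map $[V,\psi]_H\mapsto[V,\psi]_G$. *)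

theory Defs
  imports Complex_Main "HOL-Algebra.Coset" "HOL-Library.Function_Algebras"
begin

section \<open>Homomorphism groups\<close>

text \<open>
  For an abelian group \<open>A\<close>, \<open>hom_group H A\<close> is the group of homomorphisms from \<open>H\<close> to \<open>A\<close> under
  pointwise multiplication; so \<open>H\<^sup>*\<close> is \<open>hom_group H A\<close>.  The library's
  \<^const>\<open>hom\<close> does not constrain values outside the carrier; homomorphisms are made
  unique by requiring them to be extensional.
\<close>

definition hom_group ::
  "('h, 'x) monoid_scheme \<Rightarrow> ('a, 'y) monoid_scheme \<Rightarrow> ('h \<Rightarrow> 'a) monoid" where
  "hom_group H A =
    \<lparr>carrier = hom H A \<inter> extensional (carrier H),
     mult = (\<lambda>\<phi> \<psi>. \<lambda>x\<in>carrier H. \<phi> x \<otimes>\<^bsub>A\<^esub> \<psi> x),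
     one = (\<lambda>x\<in>carrier H. \<one>\<^bsub>A\<^esub>)\<rparr>"

definition unit_group :: "'k::field monoid" where
  "unit_group = \<lparr>carrier = {c. c \<noteq> 0}, mult = (*), one = 1\<rparr>"

abbreviation subgrp :: "('g, 'x) monoid_scheme \<Rightarrow> 'g set \<Rightarrow> ('g, 'x) monoid_scheme" where
  "subgrp S U \<equiv> S\<lparr>carrier := U\<rparr>"

abbreviation sub_dual ::
  "('g, 'x) monoid_scheme \<Rightarrow> ('a, 'y) monoid_scheme \<Rightarrow> 'g set \<Rightarrow> ('g \<Rightarrow> 'a) monoid" where
  "sub_dual S A U \<equiv> hom_group (subgrp S U) A"

definition subquotient_of :: "'g set monoid \<Rightarrow> ('g, 'x) monoid_scheme \<Rightarrow> bool" where
  "subquotient_of Q G \<longleftrightarrow>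
    (\<exists>P N. subgroup P G \<and> N \<lhd> subgrp G P \<and> Q = subgrp G P Mod N)"


section \<open>Splitting fields\<close>

definition scale :: "'k::field \<Rightarrow> ('i \<Rightarrow> 'k) \<Rightarrow> ('i \<Rightarrow> 'k)" where
  "scale c v = (\<lambda>i. c * v i)"

lemma module_scale: "module scale"
  by unfold_locales (simp_all add: scale_def fun_eq_iff algebra_simps)

definition linear_map_on ::
  "('i \<Rightarrow> 'k::field) set \<Rightarrow> (('i \<Rightarrow> 'k) \<Rightarrow> ('i \<Rightarrow> 'k)) \<Rightarrow> bool" where
  "linear_map_on V f \<longleftrightarrow>
    f ` V \<subseteq> V \<and> (\<forall>v\<in>V. \<forall>w\<in>V. f (v + w) = f v + f w) \<and>
    (\<forall>c. \<forall>v\<in>V. f (scale c v) = scale c (f v))"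

definition representation ::
  "('q, 'x) monoid_scheme \<Rightarrow> ('i \<Rightarrow> 'k::field) set \<Rightarrow> ('q \<Rightarrow> ('i \<Rightarrow> 'k) \<Rightarrow> ('i \<Rightarrow> 'k)) \<Rightarrow> bool" where
  "representation Q V \<rho> \<longleftrightarrow>
    module.subspace scale V \<and>
    (\<forall>q\<in>carrier Q. linear_map_on V (\<rho> q)) \<and>
    (\<forall>v\<in>V. \<rho> \<one>\<^bsub>Q\<^esub> v = v) \<and>
    (\<forall>q\<in>carrier Q. \<forall>r\<in>carrier Q. \<forall>v\<in>V. \<rho> (q \<otimes>\<^bsub>Q\<^esub> r) v = \<rho> q (\<rho> r v))"

definition irreducible_representation ::
  "('q, 'x) monoid_scheme \<Rightarrow> ('i \<Rightarrow> 'k::field) set \<Rightarrow> ('q \<Rightarrow> ('i \<Rightarrow> 'k) \<Rightarrow> ('i \<Rightarrow> 'k)) \<Rightarrow> bool" where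
  "irreducible_representation Q V \<rho> \<longleftrightarrow>
    representation Q V \<rho> \<and> V \<noteq> {0} \<and>
    (\<forall>W. module.subspace scale W \<and> W \<subseteq> V \<and> (\<forall>q\<in>carrier Q. \<rho> q ` W \<subseteq> W) \<longrightarrow> W = {0} \<or> W = V)"

text \<open>
  A field \<open>k\<close> is a splitting field of a finite group \<open>Q\<close> if the endomorphism ring of every
  simple \<open>kQ\<close>-module consists of the scalars only.  Since \<open>Q\<close> is finite, simple modules are
  finite-dimensional, so each of them is isomorphic to one whose underlying space is a subspace of
  the space of functions from the natural numbers to \<open>k\<close>.
\<close>

definition splitting_field :: "'k::field itself \<Rightarrow> ('q, 'x) monoid_scheme \<Rightarrow> bool" where
  "splitting_field _ Q \<longleftrightarrow>
    (\<forall>(V :: (nat \<Rightarrow> 'k) set) \<rho> f.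
       irreducible_representation Q V \<rho> \<and> linear_map_on V f \<and>
       (\<forall>q\<in>carrier Q. \<forall>v\<in>V. f (\<rho> q v) = \<rho> q (f v)) \<longrightarrow>
       (\<exists>c. \<forall>v\<in>V. f v = scale c v))"


section \<open>Conjugation\<close>

type_synonym ('g, 'a) fpair = "'g set \<times> ('g \<Rightarrow> 'a)"

definition conj_set :: "('g, 'x) monoid_scheme \<Rightarrow> 'g \<Rightarrow> 'g set \<Rightarrow> 'g set" where
  "conj_set S g U = (\<lambda>x. g \<otimes>\<^bsub>S\<^esub> x \<otimes>\<^bsub>S\<^esub> inv\<^bsub>S\<^esub> g) ` U"

definition conj_hom ::
  "('g, 'x) monoid_scheme \<Rightarrow> 'g \<Rightarrow> 'g set \<Rightarrow> ('g \<Rightarrow> 'a) \<Rightarrow> ('g \<Rightarrow> 'a)" where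
  "conj_hom S g U \<phi> = (\<lambda>x\<in>conj_set S g U. \<phi> (inv\<^bsub>S\<^esub> g \<otimes>\<^bsub>S\<^esub> x \<otimes>\<^bsub>S\<^esub> g))"

definition fpairs ::
  "('g, 'x) monoid_scheme \<Rightarrow> ('a, 'y) monoid_scheme \<Rightarrow> ('g, 'a) fpair set" where
  "fpairs S A = {(U, \<phi>). subgroup U S \<and> \<phi> \<in> carrier (sub_dual S A U)}"

definition fclass :: "('g, 'x) monoid_scheme \<Rightarrow> ('g, 'a) fpair \<Rightarrow> ('g, 'a) fpair set" where
  "fclass S = (\<lambda>(U, \<phi>). {(conj_set S g U, conj_hom S g U \<phi>) | g. g \<in> carrier S})"

text \<open>\<open>[U\S/V]\<close> is rendered by summing over the double cosets \<open>U g V\<close>, with one element chosen in each.\<close>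

definition double_cosets :: "('g, 'x) monoid_scheme \<Rightarrow> 'g set \<Rightarrow> 'g set \<Rightarrow> 'g set set" where
  "double_cosets S U V = {(U #>\<^bsub>S\<^esub> g) <#>\<^bsub>S\<^esub> V | g. g \<in> carrier S}"

definition pick :: "'b set \<Rightarrow> 'b" where
  "pick C = (SOME x. x \<in> C)"


section \<open>The fibered Burnside algebra\<close>

text \<open>
  Elements are the finitely supported coefficient functions on the set of classes \<open>[U, \<phi>]\<^sub>S\<close>.
\<close>

definition fburnside ::
  "('g, 'x) monoid_scheme \<Rightarrow> ('a, 'y) monoid_scheme \<Rightarrow> (('g, 'a) fpair set \<Rightarrow> 'k::field) set" where
  "fburnside S A = {x. finite {c. x c \<noteq> 0} \<and> {c. x c \<noteq> 0} \<subseteq> fclass S ` fpairs S A}"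

definition basis_vec :: "'i \<Rightarrow> ('i \<Rightarrow> 'k::field)" where
  "basis_vec i = (\<lambda>j. if j = i then 1 else 0)"

text \<open>The linear extension of a map \<open>F\<close> defined on basis elements.\<close>

definition lin_ext :: "('i \<Rightarrow> ('j \<Rightarrow> 'k::field)) \<Rightarrow> ('i \<Rightarrow> 'k) \<Rightarrow> ('j \<Rightarrow> 'k)" where
  "lin_ext F x = (\<Sum>i\<in>{i. x i \<noteq> 0}. scale (x i) (F i))"

definition fb_mult_pair ::
  "('g, 'x) monoid_scheme \<Rightarrow> ('a, 'y) monoid_scheme \<Rightarrow> ('g, 'a) fpair \<Rightarrow> ('g, 'a) fpair
    \<Rightarrow> (('g, 'a) fpair set \<Rightarrow> 'k::field)" where
  "fb_mult_pair S A = (\<lambda>(U, \<phi>) (V, \<psi>).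
    \<Sum>D\<in>double_cosets S U V.
      let g = pick D; W = U \<inter> conj_set S g V in
      basis_vec (fclass S (W, restrict \<phi> W \<otimes>\<^bsub>sub_dual S A W\<^esub> restrict (conj_hom S g V \<psi>) W)))"

definition fb_mult ::
  "('g, 'x) monoid_scheme \<Rightarrow> ('a, 'y) monoid_scheme \<Rightarrow> (('g, 'a) fpair set \<Rightarrow> 'k::field)
    \<Rightarrow> (('g, 'a) fpair set \<Rightarrow> 'k) \<Rightarrow> (('g, 'a) fpair set \<Rightarrow> 'k)" where
  "fb_mult S A x y =
    lin_ext (\<lambda>c. lin_ext (\<lambda>d. fb_mult_pair S A (pick c) (pick d)) y) x"

definition fb_res ::
  "('g, 'x) monoid_scheme \<Rightarrow> 'g set \<Rightarrow> (('g, 'a) fpair set \<Rightarrow> 'k::field)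
    \<Rightarrow> (('g, 'a) fpair set \<Rightarrow> 'k)" where
  "fb_res S H = lin_ext (\<lambda>c. case pick c of (U, \<phi>) \<Rightarrow>
    \<Sum>D\<in>double_cosets S H U.
      let g = pick D; W = H \<inter> conj_set S g U in
      basis_vec (fclass (subgrp S H) (W, restrict (conj_hom S g U \<phi>) W)))"

text \<open>\<open>fb_ind H G\<close> is induction from the subgroup \<open>H\<close> (given as a group) to \<open>G\<close>; each class of
  \<open>H\<close> is sent to the class of \<open>G\<close> containing it.\<close>

definition fb_ind ::
  "('g, 'x) monoid_scheme \<Rightarrow> ('g, 'x) monoid_scheme \<Rightarrow> (('g, 'a) fpair set \<Rightarrow> 'k::field)
    \<Rightarrow> (('g, 'a) fpair set \<Rightarrow> 'k)" where
  "fb_ind H G = lin_ext (\<lambda>c. basis_vec (fclass G (pick c)))"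

text \<open>Elements of \<open>\<bbbK>H\<^sup>*\<close> are the coefficient functions on \<open>H\<^sup>*\<close>.\<close>

definition fb_proj ::
  "('g, 'x) monoid_scheme \<Rightarrow> (('g, 'a) fpair set \<Rightarrow> 'k::field) \<Rightarrow> (('g \<Rightarrow> 'a) \<Rightarrow> 'k)" where
  "fb_proj H = lin_ext (\<lambda>c. case pick c of (U, \<phi>) \<Rightarrow> if U = carrier H then basis_vec \<phi> else 0)"

definition char_ext :: "('b \<Rightarrow> 'k::field) \<Rightarrow> ('b \<Rightarrow> 'k) \<Rightarrow> 'k" where
  "char_ext \<Phi> a = (\<Sum>\<phi>\<in>{\<phi>. a \<phi> \<noteq> 0}. a \<phi> * \<Phi> \<phi>)"


section \<open>Species and primitive idempotents\<close>

type_synonym ('g, 'a, 'k) xpair = "'g set \<times> (('g \<Rightarrow> 'a) \<Rightarrow> 'k)"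

definition xpairs ::
  "('g, 'x) monoid_scheme \<Rightarrow> ('a, 'y) monoid_scheme \<Rightarrow> ('g, 'a, 'k::field) xpair set" where
  "xpairs S A =
    {(H, \<Phi>). subgroup H S \<and> \<Phi> \<in> carrier (hom_group (sub_dual S A H) unit_group)}"

definition xact ::
  "('g, 'x) monoid_scheme \<Rightarrow> ('a, 'y) monoid_scheme \<Rightarrow> 'g
    \<Rightarrow> ('g, 'a, 'k::field) xpair \<Rightarrow> ('g, 'a, 'k) xpair" where
  "xact S A g = (\<lambda>(H, \<Phi>).
    (conj_set S g H,
     \<lambda>\<phi>\<in>carrier (sub_dual S A (conj_set S g H)).
       \<Phi> (conj_hom S (inv\<^bsub>S\<^esub> g) (conj_set S g H) \<phi>)))"

definition xstab ::
  "('g, 'x) monoid_scheme \<Rightarrow> ('a, 'y) monoid_scheme \<Rightarrow> ('g, 'a, 'k::field) xpair \<Rightarrow> 'g set" where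
  "xstab S A p = {g \<in> carrier S. xact S A g p = p}"

definition species ::
  "('g, 'x) monoid_scheme \<Rightarrow> ('g, 'a, 'k::field) xpair \<Rightarrow> (('g, 'a) fpair set \<Rightarrow> 'k) \<Rightarrow> 'k" where
  "species S = (\<lambda>(H, \<Phi>) x. char_ext \<Phi> (fb_proj (subgrp S H) (fb_res S H x)))"

text \<open>
  \<open>s\<^sup>S\<^sub>q\<close> is \<open>species S q\<close>, and \<open>e\<^sup>S\<^sub>p\<close> is the unique idempotent \<open>idem S A p\<close> described below; its
  primitivity is a consequence and is not part of the description.
\<close>

definition idem ::
  "('g, 'x) monoid_scheme \<Rightarrow> ('a, 'y) monoid_scheme \<Rightarrow> ('g, 'a, 'k::field) xpair
    \<Rightarrow> (('g, 'a) fpair set \<Rightarrow> 'k)" where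
  "idem S A p = (THE x. x \<in> fburnside S A \<and> fb_mult S A x x = x \<and>
    (\<forall>q\<in>xpairs S A. species S q x = (if \<exists>g\<in>carrier S. q = xact S A g p then 1 else 0)))"

end

theory Submission
  imports Defs "HOL-Computational_Algebra.Polynomial" "HOL-Algebra.Multiplicative_Group"
begin

text \<open>
  The proof rests on one formula for species.  Restricting a basis element \<open>[U, \<phi>]\<close> to \<open>L\<close> and
  projecting to \<open>\<bbbK>L\<^sup>*\<close> keeps exactly the cosets \<open>aU\<close> that are fixed by \<open>L\<close>, that is, those with
  \<open>L \<le> aUa\<^sup>-\<^sup>1\<close>.  Averaging over \<open>a\<close> instead of choosing representatives gives
  \<open>s([U, \<phi>]) = 1/|U| \<cdot> \<Sum>\<^sub>a \<Phi>((\<^sup>a\<phi>)|\<^sub>L)\<close> for the species \<open>s\<close> of \<open>(L, \<Phi>)\<close>, where \<open>a\<close> runs over the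
  elements with \<open>L \<le> aUa\<^sup>-\<^sup>1\<close>
  (\<open>coset_value\<close>, \<open>mark\<close>, \<open>species_eq_sum_marks\<close>).  Since no representatives occur, double coset
  formulas turn into changes of summation variable.
  
  The idempotents are then pinned down by their species alone.  Species are multiplicative
  (\<open>species_fb_mult\<close>), they separate the elements of the algebra (\<open>species_injective\<close>), and every
  indicator function of a conjugacy class of pairs is attained (\<open>exists_species_indicator\<close>).
  Separation is where the splitting field enters: at a class \<open>[U, \<phi>]\<close> in the support with \<open>|U|\<close>
  maximal, the species of the pairs \<open>(U, \<Phi>)\<close> evaluate an element of \<open>\<bbbK>U\<^sup>*\<close> at all characters of
  \<open>U\<^sup>*\<close>, and over a splitting field of characteristic zero these characters detect every element
  (\<open>splitting_field_imp_characters_separate\<close>).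
  
  For induction, splitting the sum over \<open>G\<close> into translates of \<open>H\<close> yields
  \<open>s\<^sub>q(ind x) = 1/|H| \<cdot> \<Sum>\<^sub>t s\<^sub>t\<^sub>'(x)\<close> with \<open>t' = \<^sup>t\<^sup>-\<^sup>1q\<close>, over those \<open>t\<close> in \<open>G\<close> for which \<open>t'\<close> is a pair of \<open>H\<close>
  (\<open>species_fb_ind\<close>).  For \<open>x\<close> the idempotent of \<open>p = (K, \<Psi>)\<close> this counts the \<open>t\<close> for which \<open>t'\<close> lies
  in the \<open>H\<close>-orbit of \<open>p\<close>.  If \<open>q\<close> is conjugate to \<open>p\<close>, there are \<open>|H N\<^sub>G(p)|\<close> of them, and
  \<open>|H N\<^sub>G(p)| = |H| \<cdot> |N\<^sub>G(p)| / |N\<^sub>H(p)|\<close>; otherwise there are none.  So the induced idempotent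
  and the multiple of the idempotent of \<open>G\<close> in question have the same species.
\<close>

section \<open>Characters of finite groups\<close>

lemma mem_characters:
  "\<chi> \<in> carrier (hom_group M unit_group) \<longleftrightarrow> \<chi> \<in> extensional (carrier M) \<and>
    (\<forall>x\<in>carrier M. \<chi> x \<noteq> 0) \<and>
    (\<forall>x\<in>carrier M. \<forall>y\<in>carrier M. \<chi> (x \<otimes>\<^bsub>M\<^esub> y) = \<chi> x * \<chi> y)"
  by (auto simp: hom_group_def unit_group_def hom_def)

lemma character_mult:
  "\<chi> \<in> carrier (hom_group M unit_group) \<Longrightarrow> x \<in> carrier M \<Longrightarrow> y \<in> carrier M \<Longrightarrow>
    \<chi> (x \<otimes>\<^bsub>M\<^esub> y) = \<chi> x * \<chi> y"
  by (simp add: mem_characters)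

lemma character_nonzero:
  "\<chi> \<in> carrier (hom_group M unit_group) \<Longrightarrow> x \<in> carrier M \<Longrightarrow> \<chi> x \<noteq> 0"
  by (simp add: mem_characters)

lemma (in group) inv_mult_cancel [simp]:
  assumes "g \<in> carrier G" and "x \<in> carrier G"
  shows "inv g \<otimes> (g \<otimes> x) = x" and "g \<otimes> (inv g \<otimes> x) = x"
  using assms by (simp_all flip: m_assoc)

lemma (in group) sum_translate:
  assumes "b \<in> carrier G"
  shows "(\<Sum>a\<in>carrier G. f (a \<otimes> b)) = (\<Sum>a\<in>carrier G. f a)"
    and "(\<Sum>a\<in>carrier G. f (b \<otimes> a)) = (\<Sum>a\<in>carrier G. f a)"
  by (rule sum.reindex_bij_witness[where i = "\<lambda>a. a \<otimes> inv b" and j = "\<lambda>a. a \<otimes> b"],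
      use assms in \<open>auto simp: m_assoc\<close>)
    (rule sum.reindex_bij_witness[where i = "\<lambda>a. inv b \<otimes> a" and j = "\<lambda>a. b \<otimes> a"],
      use assms in \<open>auto simp: m_assoc\<close>)

lemma finite_roots_of_unity:
  fixes n :: nat
  assumes "n > 0"
  shows "finite {z :: 'k::field. z ^ n = 1}"
proof -
  let ?p = "Polynomial.monom 1 n - 1 :: 'k poly"
  have "Polynomial.coeff ?p n = 1" using assms by simp
  then have "?p \<noteq> 0" by (metis coeff_0 zero_neq_one)
  then have "finite {z. poly ?p z = 0}" by (rule poly_roots_finite)
  then show ?thesis by (simp add: poly_monom)
qed

text \<open>
  The values of a character are roots of unity of order dividing the group order, and a field
  contains only finitely many of these.
\<close>
lemma finite_characters:
  assumes "group M" and fin: "finite (carrier M)"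
  shows "finite (carrier (hom_group M (unit_group :: 'k::field monoid)))"
proof -
  interpret group M by fact
  let ?R = "{z :: 'k. z ^ Coset.order M = 1}"
  have pos: "Coset.order M > 0" using fin by (simp add: order_gt_0_iff_finite)
  have "\<chi> \<in> carrier M \<rightarrow>\<^sub>E ?R" if \<chi>: "\<chi> \<in> carrier (hom_group M (unit_group :: 'k monoid))" for \<chi>
  proof -
    have "\<chi> \<one>\<^bsub>M\<^esub> * \<chi> \<one>\<^bsub>M\<^esub> = \<chi> \<one>\<^bsub>M\<^esub>" "\<chi> \<one>\<^bsub>M\<^esub> \<noteq> 0"
      using character_mult[OF \<chi>, of "\<one>\<^bsub>M\<^esub>" "\<one>\<^bsub>M\<^esub>"] character_nonzero[OF \<chi>] by simp_all
    then have one: "\<chi> \<one>\<^bsub>M\<^esub> = 1" by simp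
    have pow: "\<chi> (x [^]\<^bsub>M\<^esub> n) = \<chi> x ^ n" if "x \<in> carrier M" for x and n :: nat
      using that by (induction n) (simp_all add: one character_mult[OF \<chi>])
    have "\<chi> x ^ Coset.order M = 1" if "x \<in> carrier M" for x
      using pow[OF that, of "Coset.order M"] pow_order_eq_1[OF that] one by simp
    then show ?thesis using \<chi> by (auto simp: mem_characters extensional_def)
  qed
  then show ?thesis
    using finite_PiE[OF fin, of "\<lambda>_. ?R"] finite_roots_of_unity[OF pos] by (blast intro: finite_subset)
qed

lemma character_orthogonality:
  fixes \<chi> \<theta> :: "'m \<Rightarrow> 'k::field_char_0"
  assumes "group M" and \<chi>: "\<chi> \<in> carrier (hom_group M unit_group)" and \<theta>: "\<theta> \<in> carrier (hom_group M unit_group)"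
  shows "(\<Sum>m\<in>carrier M. \<chi> m / \<theta> m) = (if \<chi> = \<theta> then of_nat (card (carrier M)) else 0)"
proof (cases "\<chi> = \<theta>")
  case True
  then show ?thesis using character_nonzero[OF \<theta>] by simp
next
  case False
  interpret group M by fact
  obtain b where b: "b \<in> carrier M" "\<chi> b \<noteq> \<theta> b"
    using False \<chi> \<theta> extensionalityI[of \<chi> "carrier M" \<theta>] by (auto simp: mem_characters)
  have "(\<Sum>m\<in>carrier M. \<chi> m / \<theta> m) = (\<Sum>m\<in>carrier M. \<chi> (b \<otimes>\<^bsub>M\<^esub> m) / \<theta> (b \<otimes>\<^bsub>M\<^esub> m))"
    using sum_translate(2)[OF b(1), of "\<lambda>m. \<chi> m / \<theta> m"] by simp
  also have "\<dots> = \<chi> b / \<theta> b * (\<Sum>m\<in>carrier M. \<chi> m / \<theta> m)"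
    using b by (simp add: character_mult[OF \<chi>] character_mult[OF \<theta>] sum_distrib_left)
  finally have "(\<chi> b / \<theta> b - 1) * (\<Sum>m\<in>carrier M. \<chi> m / \<theta> m) = 0"
    by (simp add: algebra_simps)
  moreover have "\<chi> b / \<theta> b \<noteq> 1" using b character_nonzero[OF \<theta> b(1)] by simp
  ultimately show ?thesis using False by auto
qed

section \<open>Separation by characters over a splitting field\<close>

definition characters_separate :: "'k::field itself \<Rightarrow> ('m, 'z) monoid_scheme \<Rightarrow> bool" where
  "characters_separate _ M \<longleftrightarrow>
    (\<forall>a :: 'm \<Rightarrow> 'k.
      (\<forall>\<chi>\<in>carrier (hom_group M unit_group). (\<Sum>m\<in>carrier M. a m * \<chi> m) = 0) \<longrightarrow>
      (\<forall>m\<in>carrier M. a m = 0))"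

lemma vector_space_scale: "vector_space scale"
  by unfold_locales (simp_all add: scale_def fun_eq_iff algebra_simps)

lemma scale_apply: "scale c v i = c * v i"
  by (simp add: scale_def)

lemma sum_fun_apply: "(\<Sum>i\<in>I. f i) x = (\<Sum>i\<in>I. f i x)"
  by (induction I rule: infinite_finite_induct) auto

lemma subspace_scale_iff:
  "module.subspace scale V \<longleftrightarrow>
    0 \<in> V \<and> (\<forall>v\<in>V. \<forall>w\<in>V. v + w \<in> V) \<and> (\<forall>c. \<forall>v\<in>V. scale c v \<in> V)"
  by (rule module.subspace_def[OF module_scale])

text \<open>
  Strict monotonicity of dimension inside an ambient space that need not be
  finite-dimensional itself: the finite spanning set \<open>B\<close> of \<open>V\<close> makes the dimensions meaningful.
\<close>
lemma proper_subspace_dim_less: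
  fixes V W :: "('i \<Rightarrow> 'k::field) set"
  assumes W: "module.subspace scale W" and V: "module.subspace scale V"
    and "W \<subset> V" and "V \<subseteq> module.span scale B" and "finite B"
  shows "vector_space.dim scale W < vector_space.dim scale V"
proof -
  interpret vector_space "scale :: 'k \<Rightarrow> ('i \<Rightarrow> 'k) \<Rightarrow> ('i \<Rightarrow> 'k)" by (rule vector_space_scale)
  obtain C where C: "C \<subseteq> W" "independent C" "W \<subseteq> span C" "card C = dim W"
    by (rule basis_exists)
  obtain D where D: "D \<subseteq> V" "independent D" "V \<subseteq> span D" "card D = dim V"
    by (rule basis_exists)
  obtain x where x: "x \<in> V" "x \<notin> W" using assms by blast
  have "span C \<subseteq> W" using C W by (simp add: span_minimal)
  then have "x \<notin> span C" using x by blast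
  then have ind: "independent (insert x C)" using C by (simp add: independent_insertI)
  have "D \<subseteq> span B" using D(1) \<open>V \<subseteq> span B\<close> by (rule order_trans)
  with \<open>finite B\<close> D(2) have "finite D"
    using independent_span_bound by simp
  moreover have "insert x C \<subseteq> span D"
  proof (rule order_trans[OF _ D(3)])
    show "insert x C \<subseteq> V" using C(1) x(1) \<open>W \<subset> V\<close> by auto
  qed
  ultimately have "finite (insert x C) \<and> card (insert x C) \<le> card D"
    using independent_span_bound[of D "insert x C"] ind by simp
  moreover have "x \<notin> C" using C(1) x(2) by auto
  ultimately show ?thesis using C(4) D(4) by auto
qed

lemma finite_support_subset_span:
  fixes V :: "('i \<Rightarrow> 'k::field) set"
  assumes "finite I" and "\<And>v i. v \<in> V \<Longrightarrow> i \<notin> I \<Longrightarrow> v i = 0"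
  shows "V \<subseteq> module.span scale (basis_vec ` I)"
proof
  interpret vector_space "scale :: 'k \<Rightarrow> ('i \<Rightarrow> 'k) \<Rightarrow> ('i \<Rightarrow> 'k)" by (rule vector_space_scale)
  fix v assume v: "v \<in> V"
  have "v = (\<Sum>i\<in>I. scale (v i) (basis_vec i))"
  proof
    fix j
    have "(\<Sum>i\<in>I. v i * (if j = i then 1 else 0)) = (if j \<in> I then v j else 0)"
      using assms(1) by (simp add: sum.delta' if_distrib cong: if_cong)
    then show "v j = (\<Sum>i\<in>I. scale (v i) (basis_vec i)) j"
      using assms(2)[OF v, of j] by (simp add: sum_fun_apply scale_apply basis_vec_def)
  qed
  moreover have "(\<Sum>i\<in>I. scale (v i) (basis_vec i)) \<in> span (basis_vec ` I)"
    by (intro span_sum span_scale span_base imageI)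
  ultimately show "v \<in> span (basis_vec ` I)" by simp
qed

text \<open>
  An irreducible subrepresentation is a nonzero invariant subspace of least dimension; the finite
  support \<open>I\<close> bounds all dimensions that occur.
\<close>
lemma exists_irreducible_subrepresentation:
  fixes Z :: "('i \<Rightarrow> 'k::field) set"
  assumes rep: "representation Q Z \<rho>" and "Z \<noteq> {0}"
    and "finite I" and supp: "\<And>v i. v \<in> Z \<Longrightarrow> i \<notin> I \<Longrightarrow> v i = 0"
  obtains W where "W \<subseteq> Z" and "irreducible_representation Q W \<rho>"
proof -
  define P where "P W \<longleftrightarrow> module.subspace scale W \<and> W \<subseteq> Z \<and> W \<noteq> {0} \<and>
    (\<forall>q\<in>carrier Q. \<rho> q ` W \<subseteq> W)" for W :: "('i \<Rightarrow> 'k) set"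
  have "P Z" using assms by (auto simp: P_def representation_def linear_map_on_def)
  then obtain W where W: "P W" and
    min: "\<And>U. P U \<Longrightarrow> vector_space.dim scale W \<le> vector_space.dim scale U"
    using ex_has_least_nat[of P Z "vector_space.dim scale"] by blast
  have span: "W \<subseteq> module.span scale (basis_vec ` I)"
    using finite_support_subset_span[OF \<open>finite I\<close>, of W] W supp by (auto simp: P_def)
  have "U = {0} \<or> U = W"
    if U: "module.subspace scale U" "U \<subseteq> W" "\<forall>q\<in>carrier Q. \<rho> q ` U \<subseteq> U" for U
  proof (rule ccontr)
    assume "\<not> ?thesis"
    then have "P U" "U \<subset> W" using U W by (auto simp: P_def)
    then show False
      using proper_subspace_dim_less[OF U(1) _ _ span] min[of U] W \<open>finite I\<close>
      by (auto simp: P_def)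
  qed
  moreover have "representation Q W \<rho>"
    unfolding representation_def
  proof (intro conjI ballI)
    have *: "v \<in> Z" if "v \<in> W" for v using W that by (auto simp: P_def)
    show "module.subspace scale W" using W by (simp add: P_def)
    show "linear_map_on W (\<rho> q)" if "q \<in> carrier Q" for q
      using rep W that * unfolding representation_def linear_map_on_def P_def by simp
    show "\<rho> \<one>\<^bsub>Q\<^esub> v = v" if "v \<in> W" for v
      using rep *[OF that] by (simp add: representation_def)
    show "\<rho> (q \<otimes>\<^bsub>Q\<^esub> r) v = \<rho> q (\<rho> r v)" if "q \<in> carrier Q" "r \<in> carrier Q" "v \<in> W" for q r v
      using rep that *[OF \<open>v \<in> W\<close>] by (simp add: representation_def)
  qed
  ultimately have "irreducible_representation Q W \<rho>"
    using W by (auto simp: irreducible_representation_def P_def)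
  then show thesis using that W by (auto simp: P_def)
qed

text \<open>
  Suppose that the space \<open>Z\<close> of functions on \<open>M\<close> annihilated by all characters is nonzero.  It is
  invariant under translation, so it contains an irreducible subrepresentation \<open>W\<close>.  Translations
  commute because \<open>M\<close> is abelian, so by the splitting property each of them acts on \<open>W\<close> by a
  scalar.  These scalars form a character \<open>\<chi>\<close>, and a nonzero \<open>w\<close> in \<open>W\<close> must be a multiple
  \<open>c \<cdot> \<chi>\<^sup>-\<^sup>1\<close>.  Pairing \<open>w\<close> with \<open>\<chi>\<close> gives \<open>c \<cdot> |M|\<close>, which is nonzero in characteristic zero,
  contradicting \<open>w \<in> Z\<close>.
\<close>
lemma splitting_field_imp_characters_separate:
  fixes M :: "('m, 'z) monoid_scheme"
  assumes "comm_group M" and fin: "finite (carrier M)"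
    and split: "splitting_field TYPE('k::field_char_0) M"
  shows "characters_separate TYPE('k) M"
  unfolding characters_separate_def
proof (intro allI impI ballI, rule ccontr)
  interpret M: comm_group M by fact
  fix a :: "'m \<Rightarrow> 'k" and m0
  assume a: "\<forall>\<chi>\<in>carrier (hom_group M unit_group). (\<Sum>m\<in>carrier M. a m * \<chi> m) = 0"
    and m0: "m0 \<in> carrier M" "a m0 \<noteq> 0"
  \<comment> \<open>The splitting property speaks of functions on the natural numbers, so \<open>M\<close> is enumerated.\<close>
  define n where "n = card (carrier M)"
  obtain e where e: "bij_betw e {0..<n} (carrier M)"
    unfolding n_def by (rule exE[OF ex_bij_betw_nat_finite[OF fin]])
  define idx where "idx = the_inv_into {0..<n} e"
  have e_carrier: "e i \<in> carrier M" if "i < n" for i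
    using e that by (auto simp: bij_betw_def)
  have idx_less: "idx x < n" if "x \<in> carrier M" for x
    using the_inv_into_into[of e "{0..<n}" x "{0..<n}"] e that by (auto simp: bij_betw_def idx_def)
  have e_idx: "e (idx x) = x" if "x \<in> carrier M" for x
    using f_the_inv_into_f[of e "{0..<n}" x] e that by (auto simp: bij_betw_def idx_def)
  have idx_e: "idx (e i) = i" if "i < n" for i
    using the_inv_into_f_f[of e "{0..<n}" i] e that by (auto simp: bij_betw_def idx_def)
  define \<rho> :: "'m \<Rightarrow> (nat \<Rightarrow> 'k) \<Rightarrow> nat \<Rightarrow> 'k" where
    "\<rho> m v = (\<lambda>i. if i < n then v (idx (inv\<^bsub>M\<^esub> m \<otimes>\<^bsub>M\<^esub> e i)) else 0)" for m v
  have \<rho>_idx: "\<rho> m v (idx x) = v (idx (inv\<^bsub>M\<^esub> m \<otimes>\<^bsub>M\<^esub> x))" if "x \<in> carrier M" for m v x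
    using that by (simp add: \<rho>_def idx_less e_idx)
  define Z :: "(nat \<Rightarrow> 'k) set" where
    "Z = {v. (\<forall>i\<ge>n. v i = 0) \<and>
      (\<forall>\<chi>\<in>carrier (hom_group M unit_group). (\<Sum>x\<in>carrier M. v (idx x) * \<chi> x) = 0)}"
  have Z_supp: "v i = 0" if "v \<in> Z" "i \<notin> {0..<n}" for v i
    using that by (simp add: Z_def)
  have sub: "module.subspace scale Z"
    unfolding subspace_scale_iff Z_def
    by (auto simp: scale_apply distrib_right sum.distrib mult.assoc simp flip: sum_distrib_left)
  have inv: "\<rho> m v \<in> Z" if m: "m \<in> carrier M" and v: "v \<in> Z" for m v
  proof -
    have "(\<Sum>x\<in>carrier M. \<rho> m v (idx x) * \<chi> x) = 0"
      if \<chi>: "\<chi> \<in> carrier (hom_group M unit_group)" for \<chi>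
    proof -
      have "(\<Sum>x\<in>carrier M. \<rho> m v (idx x) * \<chi> x) =
          (\<Sum>x\<in>carrier M. v (idx (inv\<^bsub>M\<^esub> m \<otimes>\<^bsub>M\<^esub> x)) * \<chi> x)"
        by (simp add: \<rho>_idx)
      also have "\<dots> = (\<Sum>x\<in>carrier M. v (idx x) * \<chi> (m \<otimes>\<^bsub>M\<^esub> x))"
        by (rule sum.reindex_bij_witness[where i = "\<lambda>x. m \<otimes>\<^bsub>M\<^esub> x" and j = "\<lambda>x. inv\<^bsub>M\<^esub> m \<otimes>\<^bsub>M\<^esub> x"])
          (use m in \<open>auto simp flip: M.m_assoc\<close>)
      also have "\<dots> = \<chi> m * (\<Sum>x\<in>carrier M. v (idx x) * \<chi> x)"
        using m \<chi> by (simp add: character_mult sum_distrib_left mult_ac)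
      also have "\<dots> = 0" using v \<chi> by (simp add: Z_def)
      finally show ?thesis .
    qed
    then show ?thesis by (auto simp: Z_def \<rho>_def)
  qed
  have \<rho>_mult: "\<rho> (m \<otimes>\<^bsub>M\<^esub> q) v = \<rho> m (\<rho> q v)" if "m \<in> carrier M" "q \<in> carrier M" for m q v
    using that
    by (auto simp: fun_eq_iff \<rho>_def idx_less e_idx e_carrier M.inv_mult_group M.m_assoc)
  have \<rho>_one: "\<rho> \<one>\<^bsub>M\<^esub> v = v" if "v \<in> Z" for v
    using that by (simp add: fun_eq_iff \<rho>_def Z_def e_carrier idx_e)
  have lin: "linear_map_on Z (\<rho> m)" if "m \<in> carrier M" for m
    using inv[OF that] by (auto simp: linear_map_on_def fun_eq_iff \<rho>_def scale_apply)
  have rep: "representation M Z \<rho>"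
    using sub lin \<rho>_mult \<rho>_one by (simp add: representation_def)
  define z where "z i = (if i < n then a (e i) else 0)" for i
  have "z \<in> Z" using a by (simp add: Z_def z_def idx_less e_idx)
  moreover have "z (idx m0) \<noteq> 0" using m0 by (simp add: z_def idx_less e_idx)
  then have "z \<noteq> 0" by (metis zero_fun_apply)
  ultimately have "Z \<noteq> {0}" by blast
  then obtain W where W: "W \<subseteq> Z" and irr: "irreducible_representation M W \<rho>"
    by (rule exists_irreducible_subrepresentation[OF rep _ finite_atLeastLessThan, of 0 n])
      (use Z_supp in auto)
  have W0: "W \<noteq> {0}" and rep_W: "representation M W \<rho>"
    using irr by (simp_all add: irreducible_representation_def)
  have "0 \<in> W"
    using rep_W by (simp add: representation_def subspace_scale_iff)
  then obtain w where w: "w \<in> W" "w \<noteq> 0"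
    using W0 by blast
  have "\<exists>c. \<forall>v\<in>W. \<rho> m v = scale c v" if m: "m \<in> carrier M" for m
  proof -
    have "linear_map_on W (\<rho> m)"
      using rep_W m by (simp add: representation_def)
    moreover have "\<rho> m (\<rho> q v) = \<rho> q (\<rho> m v)" if "q \<in> carrier M" for q v
      using \<rho>_mult[OF m that] \<rho>_mult[OF that m] M.m_comm[OF m that] by simp
    ultimately show ?thesis
      using split[unfolded splitting_field_def, rule_format, of W \<rho> "\<rho> m"] irr by simp
  qed
  then obtain c where c: "\<And>m. m \<in> carrier M \<Longrightarrow> \<rho> m w = scale (c m) w"
    using w(1) by metis
  \<comment> \<open>Since \<open>w \<noteq> 0\<close>, identities between the scalars can be read off from their action on \<open>w\<close>.\<close>
  have scale_inj: "r = s" if eq: "scale r w = scale s w" for r s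
  proof -
    obtain i where "w i \<noteq> 0" using w by (auto simp: fun_eq_iff)
    then show ?thesis using fun_cong[OF eq, of i] by (simp add: scale_apply)
  qed
  have c_mult: "c (m \<otimes>\<^bsub>M\<^esub> q) = c m * c q" if "m \<in> carrier M" "q \<in> carrier M" for m q
  proof (rule scale_inj)
    have "scale (c (m \<otimes>\<^bsub>M\<^esub> q)) w = \<rho> m (scale (c q) w)"
      using that by (simp add: \<rho>_mult flip: c)
    also have "\<dots> = scale (c q) (\<rho> m w)"
      by (auto simp: fun_eq_iff \<rho>_def scale_apply)
    finally show "scale (c (m \<otimes>\<^bsub>M\<^esub> q)) w = scale (c m * c q) w"
      using that by (simp add: c) (simp add: scale_def mult_ac)
  qed
  have c_one: "c \<one>\<^bsub>M\<^esub> = 1"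
  proof (rule scale_inj)
    show "scale (c \<one>\<^bsub>M\<^esub>) w = scale 1 w"
      unfolding c[OF M.one_closed, symmetric] \<rho>_one[OF subsetD[OF W w(1)]]
      by (simp add: scale_def)
  qed
  have c_nonzero: "c m \<noteq> 0" if "m \<in> carrier M" for m
    using c_mult[OF that M.inv_closed[OF that]] that by (auto simp: c_one)
  define \<chi> where "\<chi> = (\<lambda>m\<in>carrier M. c m)"
  have "\<chi> \<in> carrier (hom_group M unit_group)"
    by (auto simp: \<chi>_def hom_group_def hom_def unit_group_def c_mult c_nonzero)
  then have "(\<Sum>x\<in>carrier M. w (idx x) * \<chi> x) = 0"
    using w W by (auto simp: Z_def)
  \<comment> \<open>Evaluating the translate of \<open>w\<close> by \<open>x\<close> at \<open>x\<close> itself shows that \<open>w\<close> is a multiple of the inverse of \<open>\<chi>\<close>.\<close>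
  moreover have w_eq: "w (idx x) * c x = w (idx \<one>\<^bsub>M\<^esub>)" if "x \<in> carrier M" for x
    using \<rho>_idx[OF that, of x w] that by (simp add: c scale_apply mult.commute)
  then have "(\<Sum>x\<in>carrier M. w (idx x) * \<chi> x) = of_nat n * w (idx \<one>\<^bsub>M\<^esub>)"
    by (simp add: \<chi>_def n_def)
  moreover have "n \<noteq> 0" using fin M.one_closed by (auto simp: n_def)
  ultimately have "w (idx \<one>\<^bsub>M\<^esub>) = 0" by simp
  then have "w (idx x) = 0" if "x \<in> carrier M" for x
    using w_eq[OF that] c_nonzero[OF that] by simp
  then have "w i = 0" for i
    using w W idx_e[of i] e_carrier[of i] by (cases "i < n") (auto simp: Z_def, metis)
  then show False using w by (auto simp: fun_eq_iff)
qed

text \<open>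
  Representations of \<open>M\<close> pull back along the surjection \<open>h\<close> without changing invariant subspaces or
  commuting endomorphisms.
\<close>
lemma splitting_field_hom_image:
  assumes h: "h \<in> hom Q M" and surj: "h ` carrier Q = carrier M" and "group Q" and "group M"
    and split: "splitting_field TYPE('k::field) Q"
  shows "splitting_field TYPE('k) M"
  unfolding splitting_field_def
proof (intro allI impI, elim conjE)
  fix V :: "(nat \<Rightarrow> 'k) set" and \<rho> f
  assume irr: "irreducible_representation M V \<rho>" and lin: "linear_map_on V f"
    and comm: "\<forall>q\<in>carrier M. \<forall>v\<in>V. f (\<rho> q v) = \<rho> q (f v)"
  have one: "h \<one>\<^bsub>Q\<^esub> = \<one>\<^bsub>M\<^esub>" by (rule hom_one) fact+
  have h_mem: "h q \<in> carrier M" if "q \<in> carrier Q" for q using h that by (rule hom_in_carrier)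
  have h_mult: "h (q \<otimes>\<^bsub>Q\<^esub> r) = h q \<otimes>\<^bsub>M\<^esub> h r" if "q \<in> carrier Q" "r \<in> carrier Q" for q r
    using h that by (simp add: hom_mult)
  have "representation Q V (\<rho> \<circ> h)"
    using irr one h_mem h_mult
    by (auto simp: irreducible_representation_def representation_def)
  moreover have "(\<forall>q\<in>carrier Q. (\<rho> \<circ> h) q ` W \<subseteq> W) \<longleftrightarrow> (\<forall>q\<in>carrier M. \<rho> q ` W \<subseteq> W)" for W
    by (simp flip: surj)
  ultimately have "irreducible_representation Q V (\<rho> \<circ> h)"
    using irr by (simp add: irreducible_representation_def)
  moreover have "\<forall>q\<in>carrier Q. \<forall>v\<in>V. f ((\<rho> \<circ> h) q v) = (\<rho> \<circ> h) q (f v)"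
    using comm h_mem by simp
  ultimately show "\<exists>c. \<forall>v\<in>V. f v = scale c v"
    using split[unfolded splitting_field_def, rule_format, of V "\<rho> \<circ> h" f] lin by simp
qed

section \<open>Conjugation of pairs\<close>

definition conj_act :: "('g, 'x) monoid_scheme \<Rightarrow> 'g \<Rightarrow> ('g, 'a) fpair \<Rightarrow> ('g, 'a) fpair" where
  "conj_act S g = (\<lambda>(U, \<phi>). (conj_set S g U, conj_hom S g U \<phi>))"

lemma fst_conj_act [simp]: "fst (conj_act S g p) = conj_set S g (fst p)"
  by (simp add: conj_act_def case_prod_beta)

lemma fclass_eq: "fclass S p = {conj_act S g p |g. g \<in> carrier S}"
  by (simp add: fclass_def conj_act_def case_prod_beta)

lemma hom_group_comm_group:
  assumes "group H" and "comm_group A"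
  shows "comm_group (hom_group H A)"
proof -
  interpret H: group H by fact
  interpret A: comm_group A by fact
  show ?thesis
  proof (rule comm_groupI)
    fix x assume x: "x \<in> carrier (hom_group H A)"
    show "\<exists>y\<in>carrier (hom_group H A). y \<otimes>\<^bsub>hom_group H A\<^esub> x = \<one>\<^bsub>hom_group H A\<^esub>"
      by (rule bexI[of _ "\<lambda>h\<in>carrier H. inv\<^bsub>A\<^esub> x h"])
        (use x in \<open>auto simp: hom_group_def hom_def A.inv_mult_group A.m_ac fun_eq_iff Pi_def extensional_def restrict_def\<close>)
  qed (auto simp: hom_group_def hom_def A.m_ac fun_eq_iff Pi_def extensional_def)
qed

context group
begin

lemma mem_conj_set:
  assumes "g \<in> carrier G" and "U \<subseteq> carrier G"
  shows "x \<in> conj_set G g U \<longleftrightarrow> x \<in> carrier G \<and> inv g \<otimes> x \<otimes> g \<in> U"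
proof
  assume "x \<in> conj_set G g U"
  then obtain u where u: "u \<in> U" "x = g \<otimes> u \<otimes> inv g" by (auto simp: conj_set_def)
  then have "u \<in> carrier G" using assms by auto
  then show "x \<in> carrier G \<and> inv g \<otimes> x \<otimes> g \<in> U"
    using u assms by (simp add: m_assoc)
next
  assume x: "x \<in> carrier G \<and> inv g \<otimes> x \<otimes> g \<in> U"
  then have "x = g \<otimes> (inv g \<otimes> x \<otimes> g) \<otimes> inv g"
    using assms by (simp add: m_assoc)
  then show "x \<in> conj_set G g U" using x unfolding conj_set_def by blast
qed

lemma conj_set_subset: "g \<in> carrier G \<Longrightarrow> U \<subseteq> carrier G \<Longrightarrow> conj_set G g U \<subseteq> carrier G"
  by (auto simp: mem_conj_set)

lemma conj_set_mult:
  assumes "g \<in> carrier G" and "h \<in> carrier G" and "U \<subseteq> carrier G"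
  shows "conj_set G (g \<otimes> h) U = conj_set G g (conj_set G h U)"
  using assms by (auto simp: mem_conj_set conj_set_subset inv_mult_group m_assoc)

lemma conj_set_one: "U \<subseteq> carrier G \<Longrightarrow> conj_set G \<one> U = U"
  by (auto simp: mem_conj_set subset_iff)

lemma conj_set_mono: "U \<subseteq> V \<Longrightarrow> conj_set G g U \<subseteq> conj_set G g V"
  by (auto simp: conj_set_def)

lemma conj_set_inv_cancel:
  assumes "g \<in> carrier G" and "U \<subseteq> carrier G"
  shows "conj_set G (inv g) (conj_set G g U) = U" and "conj_set G g (conj_set G (inv g) U) = U"
  using assms conj_set_mult[of "inv g" g U] conj_set_mult[of g "inv g" U]
  by (simp_all add: conj_set_one)

lemma card_conj_set:
  assumes "g \<in> carrier G" and "U \<subseteq> carrier G"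
  shows "card (conj_set G g U) = card U"
  unfolding conj_set_def
  by (rule card_image) (use assms in \<open>auto simp: inj_on_def subset_iff\<close>)

lemma conj_set_subgroup:
  assumes g: "g \<in> carrier G" and U: "subgroup U G"
  shows "subgroup (conj_set G g U) G"
proof -
  have sub: "U \<subseteq> carrier G" using U by (rule subgroup.subset)
  show ?thesis
  proof (rule subgroupI)
    show "conj_set G g U \<noteq> {}"
      using subgroup.one_closed[OF U] by (auto simp: conj_set_def)
    fix a b assume a: "a \<in> conj_set G g U"
    have "inv g \<otimes> inv a \<otimes> g = inv (inv g \<otimes> a \<otimes> g)"
      using a g sub by (simp add: mem_conj_set inv_mult_group m_assoc)
    then show "inv a \<in> conj_set G g U"
      using a g sub subgroup.m_inv_closed[OF U] by (simp add: mem_conj_set)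
    assume b: "b \<in> conj_set G g U"
    have "inv g \<otimes> (a \<otimes> b) \<otimes> g = (inv g \<otimes> a \<otimes> g) \<otimes> (inv g \<otimes> b \<otimes> g)"
      using a b g sub by (simp add: mem_conj_set m_assoc)
    then show "a \<otimes> b \<in> conj_set G g U"
      using a b g sub subgroup.m_closed[OF U] by (simp add: mem_conj_set)
  qed (use g sub conj_set_subset in auto)
qed

lemma conj_set_self:
  assumes U: "subgroup U G" and u: "u \<in> U"
  shows "conj_set G u U = U"
proof -
  have sub: "U \<subseteq> carrier G" using U by (rule subgroup.subset)
  have *: "conj_set G v U \<subseteq> U" if "v \<in> U" for v
    using that U by (auto simp: conj_set_def subgroup.m_closed subgroup.m_inv_closed)
  have "conj_set G u (conj_set G (inv u) U) \<subseteq> conj_set G u U"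
    using u U by (intro conj_set_mono *) (auto simp: subgroup.m_inv_closed)
  then have "U \<subseteq> conj_set G u U"
    using u sub by (simp add: conj_set_inv_cancel subset_iff)
  then show ?thesis using *[OF u] by auto
qed

end

lemma mem_sub_dual:
  "\<phi> \<in> carrier (sub_dual S A U) \<longleftrightarrow> \<phi> \<in> extensional U \<and> (\<forall>x\<in>U. \<phi> x \<in> carrier A) \<and>
    (\<forall>x\<in>U. \<forall>y\<in>U. \<phi> (x \<otimes>\<^bsub>S\<^esub> y) = \<phi> x \<otimes>\<^bsub>A\<^esub> \<phi> y)"
  by (auto simp: hom_group_def hom_def)

lemma mult_sub_dual: "\<phi> \<otimes>\<^bsub>sub_dual S A U\<^esub> \<psi> = (\<lambda>x\<in>U. \<phi> x \<otimes>\<^bsub>A\<^esub> \<psi> x)"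
  by (simp add: hom_group_def)

lemma restrict_sub_dual:
  "\<phi> \<in> carrier (sub_dual S A U) \<Longrightarrow> subgroup W S \<Longrightarrow> W \<subseteq> U \<Longrightarrow> restrict \<phi> W \<in> carrier (sub_dual S A W)"
  by (auto simp: mem_sub_dual subgroup.m_closed subset_iff)

text \<open>
  The data over which all later results are uniform; both \<open>G\<close> and its subgroup \<open>H\<close> are instances
  (\<open>subgroup_fibered_group\<close>).
\<close>
locale fibered_group = group S + fibre: comm_group A
  for S :: "('g, 'x) monoid_scheme" (structure) and A :: "('a, 'y) monoid_scheme" +
  assumes finite_carrier: "finite (carrier S)"
    and finite_dual: "\<And>U. subgroup U S \<Longrightarrow> finite (carrier (sub_dual S A U))"
begin

lemma sub_subset: "subgroup U S \<Longrightarrow> U \<subseteq> carrier S"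
  by (rule subgroup.subset)

lemma sub_finite: "subgroup U S \<Longrightarrow> finite U"
  using finite_carrier finite_subset sub_subset by blast

lemma sub_card_pos: "subgroup U S \<Longrightarrow> card U > 0"
  using finite_carrier by (rule subgroup.finite_imp_card_positive[rotated])

lemma dual_comm_group: "subgroup U S \<Longrightarrow> comm_group (sub_dual S A U)"
  by (intro hom_group_comm_group subgroup_imp_group fibre.comm_group_axioms)

lemma fpairs_iff: "(U, \<phi>) \<in> fpairs S A \<longleftrightarrow> subgroup U S \<and> \<phi> \<in> carrier (sub_dual S A U)"
  by (simp add: fpairs_def)

lemma xpairs_iff:
  "(H, \<Phi>) \<in> xpairs S A \<longleftrightarrow> subgroup H S \<and> \<Phi> \<in> carrier (hom_group (sub_dual S A H) unit_group)"
  by (simp add: xpairs_def)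

lemma conj_hom_apply:
  "g \<in> carrier S \<Longrightarrow> U \<subseteq> carrier S \<Longrightarrow> conj_hom S g U \<phi> x =
    (if x \<in> carrier S \<and> inv g \<otimes> x \<otimes> g \<in> U then \<phi> (inv g \<otimes> x \<otimes> g) else undefined)"
  by (simp add: conj_hom_def restrict_def mem_conj_set)

lemma conj_hom_dual:
  assumes g: "g \<in> carrier S" and U: "subgroup U S" and \<phi>: "\<phi> \<in> carrier (sub_dual S A U)"
  shows "conj_hom S g U \<phi> \<in> carrier (sub_dual S A (conj_set S g U))"
proof -
  note sub = sub_subset[OF U]
  have "inv g \<otimes> (x \<otimes> y) \<otimes> g = (inv g \<otimes> x \<otimes> g) \<otimes> (inv g \<otimes> y \<otimes> g)"
    if "x \<in> carrier S" "y \<in> carrier S" for x y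
    using g that by (simp add: m_assoc)
  then show ?thesis
    using g sub \<phi> subgroup.m_closed[OF U]
    by (auto simp: mem_sub_dual mem_conj_set conj_hom_apply extensional_def)
qed

lemma conj_act_mult:
  assumes "g \<in> carrier S" and "h \<in> carrier S" and "fst p \<subseteq> carrier S"
  shows "conj_act S (g \<otimes> h) p = conj_act S g (conj_act S h p)"
  using assms
  by (auto simp: conj_act_def case_prod_beta conj_set_mult conj_hom_apply conj_set_subset
      mem_conj_set fun_eq_iff inv_mult_group m_assoc)

text \<open>
  Since \<open>A\<close> is abelian, a homomorphism from \<open>U\<close> to \<open>A\<close> is constant on conjugacy classes of \<open>U\<close>.
\<close>
lemma conj_act_self:
  assumes p: "p \<in> fpairs S A" and u: "u \<in> fst p"
  shows "conj_act S u p = p"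
proof -
  obtain U \<phi> where [simp]: "p = (U, \<phi>)" by fastforce
  have U: "subgroup U S" and \<phi>: "\<phi> \<in> carrier (sub_dual S A U)" using p by (auto simp: fpairs_iff)
  have u: "u \<in> U" "u \<in> carrier S" using u sub_subset[OF U] by auto
  have "conj_hom S u U \<phi> x = \<phi> x" for x
  proof (cases "x \<in> U")
    case x: True
    have "\<phi> (inv u \<otimes> x \<otimes> u) \<otimes>\<^bsub>A\<^esub> \<phi> (inv u) = \<phi> (inv u \<otimes> x \<otimes> u \<otimes> inv u)"
      using \<phi> u x U by (simp add: mem_sub_dual subgroup.m_closed subgroup.m_inv_closed)
    also have "inv u \<otimes> x \<otimes> u \<otimes> inv u = inv u \<otimes> x"
      using u x sub_subset[OF U] by (simp add: m_assoc subset_iff)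
    also have "\<phi> \<dots> = \<phi> x \<otimes>\<^bsub>A\<^esub> \<phi> (inv u)"
      using \<phi> u x U by (simp add: mem_sub_dual subgroup.m_closed subgroup.m_inv_closed fibre.m_comm)
    finally have "\<phi> (inv u \<otimes> x \<otimes> u) = \<phi> x"
      using \<phi> u x U by (simp add: mem_sub_dual subgroup.m_closed subgroup.m_inv_closed)
    then show ?thesis
      using u x U sub_subset[OF U] by (simp add: conj_hom_apply subgroup.m_closed subgroup.m_inv_closed subset_iff)
  next
    case False
    then have "x \<notin> conj_set S u U" using u U by (simp add: conj_set_self)
    then show ?thesis using False \<phi> by (simp add: conj_hom_def mem_sub_dual extensional_def)
  qed
  then show ?thesis using u U by (simp add: conj_act_def conj_set_self fun_eq_iff)
qed

lemma conj_act_one: "p \<in> fpairs S A \<Longrightarrow> conj_act S \<one> p = p"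
  by (rule conj_act_self) (auto simp: fpairs_def subgroup.one_closed)

lemma conj_act_fpairs: "g \<in> carrier S \<Longrightarrow> p \<in> fpairs S A \<Longrightarrow> conj_act S g p \<in> fpairs S A"
  by (auto simp: conj_act_def fpairs_def conj_set_subgroup conj_hom_dual)

lemma fpairs_subset: "p \<in> fpairs S A \<Longrightarrow> fst p \<subseteq> carrier S"
  by (auto simp: fpairs_def dest!: sub_subset)

lemma fclass_conj_act:
  assumes g: "g \<in> carrier S" and p: "p \<in> fpairs S A"
  shows "fclass S (conj_act S g p) = fclass S p"
proof -
  have "conj_act S h p \<in> {conj_act S k (conj_act S g p) |k. k \<in> carrier S}" if "h \<in> carrier S" for h
    using conj_act_mult[of "h \<otimes> inv g" g p] that g fpairs_subset[OF p]
    by (auto simp: m_assoc intro!: exI[of _ "h \<otimes> inv g"])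
  moreover have "conj_act S k (conj_act S g p) \<in> {conj_act S h p |h. h \<in> carrier S}" if "k \<in> carrier S" for k
    using conj_act_mult[of k g p] that g fpairs_subset[OF p] by (auto intro!: exI[of _ "k \<otimes> g"])
  ultimately show ?thesis by (auto simp: fclass_eq)
qed

lemma pick_fclass:
  assumes p: "p \<in> fpairs S A"
  obtains g where "g \<in> carrier S" and "pick (fclass S p) = conj_act S g p"
proof -
  have "p \<in> fclass S p"
    using conj_act_one[OF p] by (auto simp: fclass_eq intro!: exI[of _ \<one>])
  then have "pick (fclass S p) \<in> fclass S p" unfolding pick_def by (rule someI)
  then show thesis using that by (auto simp: fclass_eq)
qed

lemma pick_class_fpairs: "c \<in> fclass S ` fpairs S A \<Longrightarrow> pick c \<in> fpairs S A"
  by (metis (no_types, lifting) imageE pick_fclass conj_act_fpairs)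

lemma fclass_pick: "c \<in> fclass S ` fpairs S A \<Longrightarrow> fclass S (pick c) = c"
  by (metis (no_types, lifting) imageE pick_fclass fclass_conj_act)

lemma conj_hom_restrict:
  assumes "g \<in> carrier S" and "W \<subseteq> V" and "V \<subseteq> carrier S"
  shows "conj_hom S g W (restrict \<phi> W) = restrict (conj_hom S g V \<phi>) (conj_set S g W)"
  using assms by (auto simp: fun_eq_iff conj_hom_def restrict_def mem_conj_set subset_iff)

lemma xact_mult:
  assumes g: "g \<in> carrier S" and h: "h \<in> carrier S" and q: "fst q \<subseteq> carrier S" "subgroup (fst q) S"
  shows "xact S A (g \<otimes> h) q = xact S A g (xact S A h q)"
proof -
  obtain L \<Phi> where [simp]: "q = (L, \<Phi>)" by fastforce
  have L: "subgroup L S" "L \<subseteq> carrier S" using q by auto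
  have *: "conj_hom S (inv g) (conj_set S g (conj_set S h L)) \<phi> \<in> carrier (sub_dual S A (conj_set S h L))"
    if "\<phi> \<in> carrier (sub_dual S A (conj_set S g (conj_set S h L)))" for \<phi>
    using conj_hom_dual[OF _ _ that, of "inv g"] g h L
    by (simp add: conj_set_inv_cancel conj_set_subgroup conj_set_subset)
  have **: "conj_hom S (inv (g \<otimes> h)) (conj_set S g (conj_set S h L)) \<phi> =
      conj_hom S (inv h) (conj_set S h L) (conj_hom S (inv g) (conj_set S g (conj_set S h L)) \<phi>)" for \<phi>
    using conj_act_mult[of "inv h" "inv g" "(conj_set S g (conj_set S h L), \<phi>)"] g h L
    by (simp add: conj_act_def conj_set_inv_cancel conj_set_subset inv_mult_group)
  show ?thesis
    using g h L by (simp add: xact_def conj_set_mult **) (auto intro!: restrict_ext simp: *)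
qed

lemma xact_xpairs:
  assumes g: "g \<in> carrier S" and q: "q \<in> xpairs S A"
  shows "xact S A g q \<in> xpairs S A"
proof -
  obtain L \<Phi> where [simp]: "q = (L, \<Phi>)" by fastforce
  have L: "subgroup L S" "L \<subseteq> carrier S" and \<Phi>: "\<Phi> \<in> carrier (hom_group (sub_dual S A L) unit_group)"
    using q sub_subset by (auto simp: xpairs_iff)
  define M where "M = conj_set S g L"
  have M: "subgroup M S" "M \<subseteq> carrier S" "conj_set S (inv g) M = L"
    using g L by (auto simp: M_def conj_set_subgroup conj_set_subset conj_set_inv_cancel)
  interpret dM: comm_group "sub_dual S A M" by (rule dual_comm_group) fact
  have *: "conj_hom S (inv g) M \<phi> \<in> carrier (sub_dual S A L)"
    if "\<phi> \<in> carrier (sub_dual S A M)" for \<phi>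
    using conj_hom_dual[OF _ M(1) that, of "inv g"] g M by simp
  have "conj_hom S (inv g) M (\<phi> \<otimes>\<^bsub>sub_dual S A M\<^esub> \<psi>) =
      conj_hom S (inv g) M \<phi> \<otimes>\<^bsub>sub_dual S A L\<^esub> conj_hom S (inv g) M \<psi>" for \<phi> \<psi>
  proof -
    have "g \<otimes> x \<otimes> inv g \<in> M" if "x \<in> L" for x
      using that by (auto simp: M_def conj_set_def)
    then show ?thesis
      using g by (auto simp: mult_sub_dual conj_hom_def M(3) intro!: restrict_ext)
  qed
  then have "(\<lambda>\<phi>\<in>carrier (sub_dual S A M). \<Phi> (conj_hom S (inv g) M \<phi>))
      \<in> carrier (hom_group (sub_dual S A M) unit_group)"
    using \<Phi> * dM.m_closed
    by (simp add: mem_characters)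
  then show ?thesis using M(1) by (simp add: xact_def xpairs_iff M_def)
qed

lemma xact_self:
  assumes q: "q \<in> xpairs S A" and l: "l \<in> fst q"
  shows "xact S A l q = q"
proof -
  obtain L \<Phi> where [simp]: "q = (L, \<Phi>)" by fastforce
  have L: "subgroup L S" and \<Phi>: "\<Phi> \<in> extensional (carrier (sub_dual S A L))"
    using q by (auto simp: xpairs_iff mem_characters)
  have l: "l \<in> L" "inv l \<in> L" using l subgroup.m_inv_closed[OF L] by auto
  have "conj_hom S (inv l) L \<phi> = \<phi>" if "\<phi> \<in> carrier (sub_dual S A L)" for \<phi>
    using conj_act_self[of "(L, \<phi>)" "inv l"] that l L by (simp add: fpairs_iff conj_act_def)
  then show ?thesis
    using l L \<Phi> by (simp add: xact_def conj_set_self) (auto simp: fun_eq_iff[of "restrict _ _"] extensional_def)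
qed

lemma xpairs_subset: "q \<in> xpairs S A \<Longrightarrow> fst q \<subseteq> carrier S"
  by (auto simp: xpairs_def dest!: sub_subset)

lemma xpairs_subgroup: "q \<in> xpairs S A \<Longrightarrow> subgroup (fst q) S"
  by (auto simp: xpairs_def)

lemma xact_one: "q \<in> xpairs S A \<Longrightarrow> xact S A \<one> q = q"
  by (rule xact_self) (auto simp: xpairs_def subgroup.one_closed)

lemma fst_xact: "fst (xact S A g q) = conj_set S g (fst q)"
  by (simp add: xact_def case_prod_beta)

end

section \<open>Sums over double cosets\<close>

context group
begin

lemma mem_double_coset:
  "x \<in> (U #> g) <#> V \<longleftrightarrow> (\<exists>u\<in>U. \<exists>v\<in>V. x = u \<otimes> g \<otimes> v)"
  by (auto simp: set_mult_def r_coset_def)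

lemma mem_own_double_coset:
  assumes "subgroup U G" and "subgroup V G" and "g \<in> carrier G"
  shows "g \<in> (U #> g) <#> V"
  unfolding mem_double_coset using assms(3) subgroup.one_closed[OF assms(1)] subgroup.one_closed[OF assms(2)]
  by (intro bexI[of _ \<one>]) auto

lemma double_coset_disjoint:
  assumes U: "subgroup U G" and V: "subgroup V G"
    and g: "g \<in> carrier G" and h: "h \<in> carrier G" and x: "x \<in> (U #> g) <#> V" "x \<in> (U #> h) <#> V"
  shows "(U #> g) <#> V = (U #> h) <#> V"
proof -
  have sub: "(U #> a) <#> V \<subseteq> (U #> b) <#> V"
    if a: "a \<in> carrier G" and b: "b \<in> carrier G" and xa: "x \<in> (U #> a) <#> V" and xb: "x \<in> (U #> b) <#> V" for a b
  proof
    fix y assume "y \<in> (U #> a) <#> V"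
    then obtain u v where y: "u \<in> U" "v \<in> V" "y = u \<otimes> a \<otimes> v" unfolding mem_double_coset by blast
    obtain u1 v1 where 1: "u1 \<in> U" "v1 \<in> V" "x = u1 \<otimes> a \<otimes> v1" using xa unfolding mem_double_coset by blast
    obtain u2 v2 where 2: "u2 \<in> U" "v2 \<in> V" "x = u2 \<otimes> b \<otimes> v2" using xb unfolding mem_double_coset by blast
    note c = subgroup.mem_carrier[OF U] subgroup.mem_carrier[OF V]
    have "a = inv u1 \<otimes> (u1 \<otimes> a \<otimes> v1) \<otimes> inv v1" using 1 a c by (simp add: m_assoc)
    also have "u1 \<otimes> a \<otimes> v1 = u2 \<otimes> b \<otimes> v2" using 1 2 by simp
    finally have "y = (u \<otimes> inv u1 \<otimes> u2) \<otimes> b \<otimes> (v2 \<otimes> inv v1 \<otimes> v)"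
      using y 1 2 b c by (simp add: m_assoc)
    moreover have "u \<otimes> inv u1 \<otimes> u2 \<in> U" "v2 \<otimes> inv v1 \<otimes> v \<in> V"
      using y 1 2 by (simp_all add: subgroup.m_closed[OF U] subgroup.m_inv_closed[OF U]
          subgroup.m_closed[OF V] subgroup.m_inv_closed[OF V])
    ultimately show "y \<in> (U #> b) <#> V" unfolding mem_double_coset by blast
  qed
  show ?thesis using sub[OF g h x] sub[OF h g x(2,1)] by blast
qed

text \<open>
  The fibre of \<open>(u, v) \<mapsto> ugv\<close> over \<open>agb\<close> consists of the pairs \<open>(aw, g\<^sup>-\<^sup>1w\<^sup>-\<^sup>1gb)\<close> with
  \<open>w \<in> U \<inter> gVg\<^sup>-\<^sup>1\<close>.
\<close>
lemma card_double_coset: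
  assumes fin: "finite (carrier G)" and U: "subgroup U G" and V: "subgroup V G" and g: "g \<in> carrier G"
  shows "card ((U #> g) <#> V) * card (U \<inter> conj_set G g V) = card U * card V"
proof -
  define D where "D = (U #> g) <#> V"
  define W where "W = U \<inter> conj_set G g V"
  note c = subgroup.mem_carrier[OF U] subgroup.mem_carrier[OF V]
  have finU: "finite U" and finV: "finite V"
    using fin subgroup.subset[OF U] subgroup.subset[OF V] by (auto intro: finite_subset)
  have D: "D = (\<lambda>(u, v). u \<otimes> g \<otimes> v) ` (U \<times> V)"
    unfolding D_def set_eq_iff mem_double_coset image_iff by fastforce
  have fibre: "card {p \<in> U \<times> V. (\<lambda>(u, v). u \<otimes> g \<otimes> v) p = d} = card W" if d: "d \<in> D" for d
  proof -
    obtain a b where ab: "a \<in> U" "b \<in> V" "d = a \<otimes> g \<otimes> b" using d by (auto simp: D)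
    have "bij_betw (\<lambda>w. (a \<otimes> w, inv g \<otimes> inv w \<otimes> g \<otimes> b)) W {p \<in> U \<times> V. (\<lambda>(u, v). u \<otimes> g \<otimes> v) p = d}"
    proof (rule bij_betw_byWitness[where f' = "\<lambda>(u, v). inv a \<otimes> u"])
      show "\<forall>w\<in>W. (\<lambda>(u, v). inv a \<otimes> u) (a \<otimes> w, inv g \<otimes> inv w \<otimes> g \<otimes> b) = w"
        using ab c by (simp add: W_def)
      show "\<forall>p\<in>{p \<in> U \<times> V. (\<lambda>(u, v). u \<otimes> g \<otimes> v) p = d}.
          (a \<otimes> ((\<lambda>(u, v). inv a \<otimes> u) p),
            inv g \<otimes> inv ((\<lambda>(u, v). inv a \<otimes> u) p) \<otimes> g \<otimes> b) = p"
      proof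
        fix p assume "p \<in> {p \<in> U \<times> V. (\<lambda>(u, v). u \<otimes> g \<otimes> v) p = d}"
        then obtain u v where p: "p = (u, v)" and uv: "u \<in> U" "v \<in> V" "u \<otimes> g \<otimes> v = d" by auto
        have "inv g \<otimes> inv (inv a \<otimes> u) \<otimes> g \<otimes> b = inv g \<otimes> inv u \<otimes> (a \<otimes> g \<otimes> b)"
          using uv(1,2) ab(1,2) c g by (simp add: inv_mult_group m_assoc)
        also have "a \<otimes> g \<otimes> b = u \<otimes> g \<otimes> v" using uv ab by simp
        also have "inv g \<otimes> inv u \<otimes> (u \<otimes> g \<otimes> v) = v" using uv(1,2) c g by (simp add: m_assoc)
        finally show "(a \<otimes> ((\<lambda>(u, v). inv a \<otimes> u) p),
            inv g \<otimes> inv ((\<lambda>(u, v). inv a \<otimes> u) p) \<otimes> g \<otimes> b) = p"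
          using uv(1,2) ab(1,2) c by (simp add: p)
      qed
      show "(\<lambda>w. (a \<otimes> w, inv g \<otimes> inv w \<otimes> g \<otimes> b)) ` W \<subseteq> {p \<in> U \<times> V. (\<lambda>(u, v). u \<otimes> g \<otimes> v) p = d}"
      proof (rule image_subsetI)
        fix w assume w: "w \<in> W"
        then have wU: "w \<in> U" "w \<in> carrier G" and wV: "inv g \<otimes> w \<otimes> g \<in> V"
          using g subgroup.subset[OF V] c by (auto simp: W_def mem_conj_set)
        have "a \<otimes> w \<in> U" using ab wU by (simp add: subgroup.m_closed[OF U])
        moreover have "inv g \<otimes> inv w \<otimes> g = inv (inv g \<otimes> w \<otimes> g)"
          using g wU by (simp add: inv_mult_group m_assoc)
        then have "inv g \<otimes> inv w \<otimes> g \<otimes> b \<in> V"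
          using wV ab by (simp add: subgroup.m_closed[OF V] subgroup.m_inv_closed[OF V])
        moreover have "a \<otimes> w \<otimes> g \<otimes> (inv g \<otimes> inv w \<otimes> g \<otimes> b) = d"
          using ab wU g c by (simp add: m_assoc)
        ultimately show "(a \<otimes> w, inv g \<otimes> inv w \<otimes> g \<otimes> b) \<in> {p \<in> U \<times> V. (\<lambda>(u, v). u \<otimes> g \<otimes> v) p = d}"
          by simp
      qed
      show "(\<lambda>(u, v). inv a \<otimes> u) ` {p \<in> U \<times> V. (\<lambda>(u, v). u \<otimes> g \<otimes> v) p = d} \<subseteq> W"
      proof (rule image_subsetI)
        fix p assume "p \<in> {p \<in> U \<times> V. (\<lambda>(u, v). u \<otimes> g \<otimes> v) p = d}"
        then obtain u v where p: "p = (u, v)" and uv: "u \<in> U" "v \<in> V" "u \<otimes> g \<otimes> v = d" by auto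
        have "inv g \<otimes> (inv a \<otimes> u) \<otimes> g = inv g \<otimes> inv a \<otimes> (u \<otimes> g \<otimes> v) \<otimes> inv v"
          using uv(1,2) ab(1) c g by (simp add: m_assoc)
        also have "u \<otimes> g \<otimes> v = a \<otimes> g \<otimes> b" using uv ab by simp
        also have "inv g \<otimes> inv a \<otimes> (a \<otimes> g \<otimes> b) \<otimes> inv v = b \<otimes> inv v"
          using uv(1,2) ab(1,2) c g by (simp add: m_assoc)
        finally have "inv g \<otimes> (inv a \<otimes> u) \<otimes> g \<in> V"
          using uv ab by (simp add: subgroup.m_closed[OF V] subgroup.m_inv_closed[OF V])
        then show "(\<lambda>(u, v). inv a \<otimes> u) p \<in> W"
          using uv(1) ab(1) c g subgroup.subset[OF V]
          by (simp add: p W_def mem_conj_set subgroup.m_closed[OF U] subgroup.m_inv_closed[OF U])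
      qed
    qed
    then show ?thesis by (rule bij_betw_same_card[symmetric])
  qed
  have "card U * card V = card (U \<times> V)" by (simp add: card_cartesian_product)
  also have "\<dots> = (\<Sum>d\<in>D. card {p \<in> U \<times> V. (\<lambda>(u, v). u \<otimes> g \<otimes> v) p = d})"
    using sum.group[of "U \<times> V" D "\<lambda>(u, v). u \<otimes> g \<otimes> v" "\<lambda>_. 1 :: nat"] finU finV by (simp add: D)
  also have "\<dots> = card D * card W" by (simp add: fibre)
  finally show ?thesis by (simp add: D_def W_def)
qed

lemma pick_double_coset:
  assumes U: "subgroup U G" and V: "subgroup V G" and D: "D \<in> double_cosets G U V"
  shows "pick D \<in> carrier G" and "(U #> pick D) <#> V = D"
proof -
  obtain g where g: "g \<in> carrier G" "D = (U #> g) <#> V" using D by (auto simp: double_cosets_def)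
  note self = mem_own_double_coset[OF U V]
  have "pick D \<in> D" unfolding pick_def by (rule someI[of _ g]) (use g self in simp)
  then show p: "pick D \<in> carrier G"
    using g subgroup.mem_carrier[OF U] subgroup.mem_carrier[OF V] by (auto simp: mem_double_coset)
  show "(U #> pick D) <#> V = D"
    using double_coset_disjoint[OF U V g(1) p, of "pick D"] \<open>pick D \<in> D\<close> g self[OF p] by simp
qed

text \<open>
  This is how sums over double coset representatives are removed: the coset of \<open>g\<close> has
  \<open>|U| \<cdot> |V| / |U \<inter> gVg\<^sup>-\<^sup>1|\<close> elements, so weighting a representative by \<open>1 / |U \<inter> gVg\<^sup>-\<^sup>1|\<close> amounts to a
  uniform sum over the whole group.
\<close>
lemma sum_double_cosets:
  fixes F :: "'a \<Rightarrow> 'k::field_char_0"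
  assumes fin: "finite (carrier G)" and U: "subgroup U G" and V: "subgroup V G"
    and inv: "\<And>u g v. u \<in> U \<Longrightarrow> g \<in> carrier G \<Longrightarrow> v \<in> V \<Longrightarrow> F (u \<otimes> g \<otimes> v) = F g"
  shows "(\<Sum>D\<in>double_cosets G U V. F (pick D) / of_nat (card (U \<inter> conj_set G (pick D) V))) =
    (\<Sum>g\<in>carrier G. F g) / (of_nat (card U) * of_nat (card V))"
proof -
  note c = subgroup.mem_carrier[OF U] subgroup.mem_carrier[OF V]
  let ?coset = "\<lambda>g. (U #> g) <#> V"
  have dc: "double_cosets G U V = ?coset ` carrier G"
    by (auto simp: double_cosets_def)
  have fibre: "{g \<in> carrier G. ?coset g = D} = D" if "D \<in> double_cosets G U V" for D
  proof -
    note p = pick_double_coset[OF U V that]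
    note self = mem_own_double_coset[OF U V]
    have "?coset (pick D) \<subseteq> carrier G" using p(1) c by (auto simp: mem_double_coset)
    then have sub: "D \<subseteq> carrier G" unfolding p(2) .
    have "?coset g = D" if "g \<in> D" for g
      using double_coset_disjoint[OF U V p(1), of g g] subsetD[OF sub that] self that by (simp add: p(2))
    then show ?thesis using self subsetD[OF sub] by auto
  qed
  have "(\<Sum>g\<in>carrier G. F g) = (\<Sum>D\<in>double_cosets G U V. \<Sum>g\<in>{g \<in> carrier G. ?coset g = D}. F g)"
    using sum.image_gen[OF fin, of F ?coset] by (simp add: dc)
  also have "\<dots> = (\<Sum>D\<in>double_cosets G U V. of_nat (card D) * F (pick D))"
  proof (rule sum.cong[OF refl])
    fix D assume D: "D \<in> double_cosets G U V"
    note p = pick_double_coset[OF U V D]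
    have "F g = F (pick D)" if "g \<in> D" for g
    proof -
      from that have "g \<in> ?coset (pick D)" by (simp add: p(2))
      then show ?thesis using inv p(1) by (auto simp: mem_double_coset)
    qed
    then show "(\<Sum>g\<in>{g \<in> carrier G. ?coset g = D}. F g) = of_nat (card D) * F (pick D)"
      by (simp add: fibre[OF D])
  qed
  finally have "(\<Sum>g\<in>carrier G. F g) / (of_nat (card U) * of_nat (card V)) =
      (\<Sum>D\<in>double_cosets G U V. of_nat (card D) * F (pick D) / (of_nat (card U) * of_nat (card V)))"
    by (simp add: sum_divide_distrib)
  also have "\<dots> = (\<Sum>D\<in>double_cosets G U V. F (pick D) / of_nat (card (U \<inter> conj_set G (pick D) V)))"
  proof (rule sum.cong[OF refl])
    fix D assume D: "D \<in> double_cosets G U V"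
    note p = pick_double_coset[OF U V D]
    have eq: "of_nat (card U) * of_nat (card V) =
        (of_nat (card D) * of_nat (card (U \<inter> conj_set G (pick D) V)) :: 'k)"
      using card_double_coset[OF fin U V p(1)] unfolding p(2) by (metis of_nat_mult)
    have "of_nat (card U) * of_nat (card V) \<noteq> (0 :: 'k)"
      using subgroup.finite_imp_card_positive[OF U fin] subgroup.finite_imp_card_positive[OF V fin] by simp
    then show "of_nat (card D) * F (pick D) / (of_nat (card U) * of_nat (card V)) =
        F (pick D) / of_nat (card (U \<inter> conj_set G (pick D) V))"
      unfolding eq by simp
  qed
  finally show ?thesis ..
qed

end

section \<open>Values of species on fixed cosets\<close>

text \<open>
  The contribution of the coset \<open>aU\<close> to the species of \<open>(L, \<Phi>)\<close> at \<open>[U, \<phi>]\<close>.  The inclusion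
  \<open>L \<le> aUa\<^sup>-\<^sup>1\<close> says that \<open>L\<close> fixes \<open>aU\<close> under left multiplication.
\<close>
definition coset_value ::
  "('g, 'x) monoid_scheme \<Rightarrow> ('g, 'a, 'k::field) xpair \<Rightarrow> ('g, 'a) fpair \<Rightarrow> 'g \<Rightarrow> 'k" where
  "coset_value S = (\<lambda>(L, \<Phi>) (U, \<phi>) a.
    if L \<subseteq> conj_set S a U then \<Phi> (restrict (conj_hom S a U \<phi>) L) else 0)"

context fibered_group
begin

lemma coset_value_conj_act:
  "a \<in> carrier S \<Longrightarrow> b \<in> carrier S \<Longrightarrow> fst p \<subseteq> carrier S \<Longrightarrow>
    coset_value S q (conj_act S b p) a = coset_value S q p (a \<otimes> b)"
  using conj_act_mult[of a b p]
  by (cases q; cases p) (simp add: coset_value_def conj_act_def)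

lemma coset_value_right:
  assumes "a \<in> carrier S" and p: "p \<in> fpairs S A" and u: "u \<in> fst p"
  shows "coset_value S q p (a \<otimes> u) = coset_value S q p a"
proof -
  have "u \<in> carrier S" using u fpairs_subset[OF p] by auto
  then show ?thesis
    using coset_value_conj_act[of a u p q] assms fpairs_subset[OF p] by (simp add: conj_act_self)
qed

lemma coset_value_xact:
  assumes a: "a \<in> carrier S" and g: "g \<in> carrier S" and p: "p \<in> fpairs S A" and q: "q \<in> xpairs S A"
  shows "coset_value S (xact S A g q) p a = coset_value S q p (inv g \<otimes> a)"
proof -
  obtain L \<Phi> where [simp]: "q = (L, \<Phi>)" by fastforce
  obtain U \<phi> where [simp]: "p = (U, \<phi>)" by fastforce
  have L: "subgroup L S" "L \<subseteq> carrier S" using q sub_subset by (auto simp: xpairs_iff)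
  have U: "subgroup U S" "U \<subseteq> carrier S" and \<phi>: "\<phi> \<in> carrier (sub_dual S A U)"
    using p sub_subset by (auto simp: fpairs_iff)
  have aU: "conj_set S a U \<subseteq> carrier S" using a U by (simp add: conj_set_subset)
  have eq: "conj_set S (inv g \<otimes> a) U = conj_set S (inv g) (conj_set S a U)"
    using a g U by (simp add: conj_set_mult)
  have iff: "conj_set S g L \<subseteq> conj_set S a U \<longleftrightarrow> L \<subseteq> conj_set S (inv g \<otimes> a) U"
  proof
    assume "conj_set S g L \<subseteq> conj_set S a U"
    then have "conj_set S (inv g) (conj_set S g L) \<subseteq> conj_set S (inv g) (conj_set S a U)"
      by (rule conj_set_mono)
    then show "L \<subseteq> conj_set S (inv g \<otimes> a) U" using g L eq by (simp add: conj_set_inv_cancel)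
  next
    assume "L \<subseteq> conj_set S (inv g \<otimes> a) U"
    then have "conj_set S g L \<subseteq> conj_set S g (conj_set S (inv g) (conj_set S a U))"
      unfolding eq by (rule conj_set_mono)
    then show "conj_set S g L \<subseteq> conj_set S a U" using g aU by (simp add: conj_set_inv_cancel)
  qed
  show ?thesis
  proof (cases "conj_set S g L \<subseteq> conj_set S a U")
    case True
    have "restrict (conj_hom S a U \<phi>) (conj_set S g L) \<in> carrier (sub_dual S A (conj_set S g L))"
      by (intro restrict_sub_dual[OF conj_hom_dual[OF a U(1) \<phi>]] conj_set_subgroup[OF g L(1)] True)
    moreover have "conj_hom S (inv g) (conj_set S g L) (restrict (conj_hom S a U \<phi>) (conj_set S g L)) =
        restrict (conj_hom S (inv g \<otimes> a) U \<phi>) L"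
      using conj_hom_restrict[OF _ True aU, of "inv g"] conj_act_mult[of "inv g" a "(U, \<phi>)"] g a U L
      by (simp add: conj_set_inv_cancel conj_act_def)
    ultimately show ?thesis using True iff by (simp add: coset_value_def xact_def)
  qed (simp add: coset_value_def xact_def iff)
qed

text \<open>
  Left invariance under \<open>L\<close> holds because \<open>L\<close> stabilizes each pair \<open>(L, \<Phi>)\<close>; together with right
  invariance under \<open>U\<close> this makes the value a function on double cosets.
\<close>
lemma coset_value_left:
  assumes a: "a \<in> carrier S" and p: "p \<in> fpairs S A" and q: "q \<in> xpairs S A" and l: "l \<in> fst q"
  shows "coset_value S q p (l \<otimes> a) = coset_value S q p a"
proof -
  have L: "subgroup (fst q) S" using q by (rule xpairs_subgroup)
  have "inv l \<in> fst q" "l \<in> carrier S" using l L subgroup.m_inv_closed[OF L] subgroup.mem_carrier[OF L] by auto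
  then show ?thesis using coset_value_xact[OF a _ p q, of "inv l"] by (simp add: xact_self q)
qed

end

section \<open>Linear extension\<close>

lemma lin_ext_superset:
  assumes "finite C" and "{i. x i \<noteq> 0} \<subseteq> C"
  shows "lin_ext F x = (\<Sum>i\<in>C. scale (x i) (F i))"
  unfolding lin_ext_def
  by (rule sum.mono_neutral_left) (use assms in \<open>auto simp: fun_eq_iff scale_apply\<close>)

lemma support_basis_vec: "{j. basis_vec i j \<noteq> (0 :: 'k::field)} = {i}"
  by (auto simp: basis_vec_def)

lemma lin_ext_basis_vec: "lin_ext F (basis_vec i) = F i"
  by (simp add: lin_ext_def support_basis_vec) (simp add: scale_def basis_vec_def)

lemma support_sum_scale:
  fixes v :: "'i \<Rightarrow> 'j \<Rightarrow> 'k::field"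
  assumes "\<And>i. i \<in> I \<Longrightarrow> {j. v i j \<noteq> 0} \<subseteq> C"
  shows "{j. (\<Sum>i\<in>I. scale (a i) (v i)) j \<noteq> 0} \<subseteq> C"
proof clarify
  fix j assume "(\<Sum>i\<in>I. scale (a i) (v i)) j \<noteq> 0"
  then have "\<exists>i\<in>I. v i j \<noteq> 0"
    by (rule contrapos_np) (simp add: sum_fun_apply scale_apply)
  then show "j \<in> C" using assms by auto
qed

text \<open>
  Linear extension is linear only on finitely supported functions, because a sum over an infinite
  set is zero by convention; the common bound \<open>C\<close> keeps all supports finite.
\<close>
lemma lin_ext_sum_scale:
  fixes v :: "'i \<Rightarrow> 'j \<Rightarrow> 'k::field"
  assumes C: "finite C" "\<And>i. i \<in> I \<Longrightarrow> {j. v i j \<noteq> 0} \<subseteq> C"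
  shows "lin_ext F (\<Sum>i\<in>I. scale (a i) (v i)) = (\<Sum>i\<in>I. scale (a i) (lin_ext F (v i)))"
proof
  fix k
  have "lin_ext F (\<Sum>i\<in>I. scale (a i) (v i)) k = (\<Sum>j\<in>C. (\<Sum>i\<in>I. a i * v i j) * F j k)"
    by (subst lin_ext_superset[OF C(1) support_sum_scale[OF C(2)]])
      (simp_all add: sum_fun_apply scale_apply)
  also have "\<dots> = (\<Sum>i\<in>I. a i * (\<Sum>j\<in>C. v i j * F j k))"
    unfolding sum_distrib_left sum_distrib_right by (subst sum.swap) (simp add: mult.assoc)
  also have "\<dots> = (\<Sum>i\<in>I. scale (a i) (lin_ext F (v i))) k"
    by (simp add: sum_fun_apply scale_apply lin_ext_superset[OF C(1) C(2)])
  finally show "lin_ext F (\<Sum>i\<in>I. scale (a i) (v i)) k = (\<Sum>i\<in>I. scale (a i) (lin_ext F (v i))) k" .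
qed

lemma lin_ext_sum_basis_vec:
  assumes "finite I"
  shows "lin_ext F (\<Sum>i\<in>I. basis_vec (k i)) = (\<Sum>i\<in>I. F (k i))"
  using lin_ext_sum_scale[of "k ` I" I "\<lambda>i. basis_vec (k i)" F "\<lambda>_. 1"] assms
  by (simp add: support_basis_vec lin_ext_basis_vec) (simp add: scale_def)

text \<open>
  Viewing scalars as functions on a one-element type transfers the rules for linear extension.
\<close>
lemma char_ext_eq_lin_ext: "char_ext \<Phi> a = lin_ext (\<lambda>\<phi> (_ :: unit). \<Phi> \<phi>) a ()"
  by (simp add: char_ext_def lin_ext_def sum_fun_apply scale_apply)

lemma char_ext_basis_vec: "char_ext \<Phi> (basis_vec \<phi>) = \<Phi> \<phi>"
  by (simp add: char_ext_eq_lin_ext lin_ext_basis_vec)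

lemma char_ext_zero: "char_ext \<Phi> 0 = 0"
  by (simp add: char_ext_def)

lemma char_ext_sum_scale:
  assumes "finite C" and "\<And>i. i \<in> I \<Longrightarrow> {j. v i j \<noteq> 0} \<subseteq> C"
  shows "char_ext \<Phi> (\<Sum>i\<in>I. scale (a i) (v i)) = (\<Sum>i\<in>I. a i * char_ext \<Phi> (v i))"
  by (simp add: char_ext_eq_lin_ext lin_ext_sum_scale[OF assms] sum_fun_apply scale_apply)

section \<open>Species as averages over cosets\<close>

text \<open>
  The value of the species of \<open>q\<close> at the class of \<open>p\<close>, as \<open>species_basis_vec\<close> shows.  For trivial
  \<open>A\<close> it is the classical mark, the number of fixed points of \<open>L\<close> on \<open>S/U\<close>.
\<close>
definition mark :: "('g, 'x) monoid_scheme \<Rightarrow> ('g, 'a, 'k::field) xpair \<Rightarrow> ('g, 'a) fpair \<Rightarrow> 'k" where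
  "mark S q p = (\<Sum>a\<in>carrier S. coset_value S q p a) / of_nat (card (fst p))"

context group
begin

lemma conj_act_subgrp:
  assumes "subgroup H G" and "h \<in> H"
  shows "conj_set (subgrp G H) h W = conj_set G h W"
    and "conj_act (subgrp G H) h p = conj_act G h p"
    and "xact (subgrp G H) A h q = xact G A h q"
  using m_inv_consistent[OF assms] m_inv_consistent[OF assms(1) subgroup.m_inv_closed[OF assms]]
  by (auto simp: conj_act_def conj_hom_def conj_set_def xact_def case_prod_beta)

end

context fibered_group
begin

lemma subgroup_fibered_group:
  assumes H: "subgroup H S"
  shows "fibered_group (subgrp S H) A"
proof -
  interpret H: group "subgrp S H" using H by (rule subgroup_imp_group)
  show ?thesis
  proof
    show "finite (carrier (subgrp S H))" using sub_finite[OF H] by simp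
    fix U assume "subgroup U (subgrp S H)"
    then have "subgroup U S" using H incl_subgroup by blast
    then show "finite (carrier (sub_dual (subgrp S H) A U))" using finite_dual by simp
  qed
qed

lemma finite_subgroups: "finite {U. subgroup U S}"
  by (rule finite_subset[of _ "Pow (carrier S)"]) (use sub_subset finite_carrier in auto)

lemma finite_fpairs: "finite (fpairs S A)"
proof -
  have "fpairs S A = Sigma {U. subgroup U S} (\<lambda>U. carrier (sub_dual S A U))"
    by (auto simp: fpairs_def)
  then show ?thesis using finite_subgroups finite_dual by auto
qed

lemma finite_classes: "finite (fclass S ` fpairs S A)"
  using finite_fpairs by simp

lemma fburnside_iff: "x \<in> fburnside S A \<longleftrightarrow> {c. x c \<noteq> 0} \<subseteq> fclass S ` fpairs S A"
  using finite_subset[OF _ finite_classes] by (auto simp: fburnside_def)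

lemma basis_vec_fburnside: "p \<in> fpairs S A \<Longrightarrow> basis_vec (fclass S p) \<in> fburnside S A"
  by (simp add: fburnside_iff support_basis_vec)

lemma sum_scale_fburnside:
  "(\<And>i. i \<in> I \<Longrightarrow> v i \<in> fburnside S A) \<Longrightarrow> (\<Sum>i\<in>I. scale (a i) (v i)) \<in> fburnside S A"
  unfolding fburnside_iff by (rule support_sum_scale)

lemma lin_ext_fburnside:
  "x \<in> fburnside S A \<Longrightarrow> lin_ext F x = (\<Sum>c\<in>fclass S ` fpairs S A. scale (x c) (F c))"
  by (rule lin_ext_superset[OF finite_classes]) (simp add: fburnside_iff)

lemma mark_conj_act:
  assumes "b \<in> carrier S" and p: "p \<in> fpairs S A"
  shows "mark S q (conj_act S b p) = mark S q p"
  using assms fpairs_subset[OF p] sum_translate(1)[OF assms(1), of "coset_value S q p"]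
  by (simp add: mark_def coset_value_conj_act card_conj_set)

lemma mark_pick: "p \<in> fpairs S A \<Longrightarrow> mark S q (pick (fclass S p)) = mark S q p"
  by (metis (no_types, lifting) pick_fclass mark_conj_act)

lemma mark_xact:
  assumes g: "g \<in> carrier S" and p: "p \<in> fpairs S A" and q: "q \<in> xpairs S A"
  shows "mark S (xact S A g q) p = mark S q p"
  using sum_translate(2)[of "inv g" "coset_value S q p"] g
  by (simp add: mark_def coset_value_xact[OF _ g p q])

text \<open>
  The projection to \<open>\<bbbK>L\<^sup>*\<close> kills the classes of proper subgroups of \<open>L\<close>, and the class of a pair
  \<open>(L, \<psi>)\<close> under \<open>L\<close> has that pair as its only member.  So the chosen representative of a class
  does not influence the value.
\<close>
lemma restricted_class_value:
  assumes L: "subgroup L S" and p: "(U, \<phi>) \<in> fpairs S A" and g: "g \<in> carrier S"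
  shows "(case pick (fclass (subgrp S L) (L \<inter> conj_set S g U, restrict (conj_hom S g U \<phi>) (L \<inter> conj_set S g U))) of
      (V, \<psi>) \<Rightarrow> if V = L then \<Phi> \<psi> else 0) = coset_value S (L, \<Phi>) (U, \<phi>) g"
proof -
  interpret L: fibered_group "subgrp S L" A using L by (rule subgroup_fibered_group)
  define W where "W = L \<inter> conj_set S g U"
  define \<chi> where "\<chi> = restrict (conj_hom S g U \<phi>) W"
  have U: "subgroup U S" "\<phi> \<in> carrier (sub_dual S A U)" using p by (auto simp: fpairs_iff)
  have "subgroup W S" unfolding W_def
    using L conj_set_subgroup[OF g U(1)] by (rule subgroups_Inter_pair)
  then have W: "subgroup W (subgrp S L)"
    by (rule subgroup_incl[OF _ L]) (simp add: W_def)
  have "\<chi> \<in> carrier (sub_dual S A W)"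
    unfolding \<chi>_def by (rule restrict_sub_dual[OF conj_hom_dual[OF g U]]) (use \<open>subgroup W S\<close> in \<open>auto simp: W_def\<close>)
  then have pair: "(W, \<chi>) \<in> fpairs (subgrp S L) A" using W by (simp add: L.fpairs_iff)
  obtain h where h: "h \<in> L" "pick (fclass (subgrp S L) (W, \<chi>)) = conj_act (subgrp S L) h (W, \<chi>)"
    using L.pick_fclass[OF pair] by auto
  have iff: "L \<subseteq> conj_set S g U \<longleftrightarrow> W = L" by (auto simp: W_def)
  show ?thesis
  proof (cases "W = L")
    case True
    then have "pick (fclass (subgrp S L) (W, \<chi>)) = (W, \<chi>)"
      using L.conj_act_self[OF pair] h by simp
    moreover have "\<chi> = restrict (conj_hom S g U \<phi>) L" by (simp add: \<chi>_def True)
    ultimately show ?thesis using True iff unfolding W_def[symmetric] \<chi>_def[symmetric]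
      by (simp add: coset_value_def)
  next
    case False
    have hS: "h \<in> carrier S" using subgroup.mem_carrier[OF L h(1)] .
    have "card (conj_set S h W) = card W"
      using hS \<open>subgroup W S\<close> by (simp add: card_conj_set sub_subset)
    moreover have "card W < card L"
      using False sub_finite[OF L] by (intro psubset_card_mono) (auto simp: W_def)
    ultimately have "conj_set S h W \<noteq> L" by auto
    then show ?thesis
      using h False iff L unfolding W_def[symmetric] \<chi>_def[symmetric]
      by (simp add: coset_value_def conj_act_def conj_act_subgrp(1))
  qed
qed

text \<open>
  Only double cosets with \<open>L \<inter> aUa\<^sup>-\<^sup>1 = L\<close> contribute, so the weight in \<open>sum_double_cosets\<close> is the
  constant \<open>1/|L|\<close>.
\<close>
lemma sum_coset_values:
  assumes q: "q \<in> xpairs S A" and p: "p \<in> fpairs S A"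
  shows "(\<Sum>D\<in>double_cosets S (fst q) (fst p). coset_value S q p (pick D)) =
    (mark S q p :: 'k::field_char_0)"
proof -
  define L where "L = fst q"
  define U where "U = fst p"
  have L: "subgroup L S" using q by (simp add: L_def xpairs_subgroup)
  have U: "subgroup U S" using p by (auto simp: U_def fpairs_def)
  note c = subgroup.mem_carrier[OF L] subgroup.mem_carrier[OF U]
  have "(\<Sum>D\<in>double_cosets S L U. coset_value S q p (pick D)) =
      (\<Sum>D\<in>double_cosets S L U. of_nat (card L) * coset_value S q p (pick D) /
        of_nat (card (L \<inter> conj_set S (pick D) U)))"
  proof (rule sum.cong[OF refl])
    fix D
    show "coset_value S q p (pick D) = of_nat (card L) * coset_value S q p (pick D) /
        of_nat (card (L \<inter> conj_set S (pick D) U))"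
      using sub_card_pos[OF L] by (auto simp: coset_value_def case_prod_beta Int_absorb2 L_def U_def)
  qed
  also have "\<dots> = (\<Sum>g\<in>carrier S. of_nat (card L) * coset_value S q p g) / (of_nat (card L) * of_nat (card U))"
    by (rule sum_double_cosets[OF finite_carrier L U])
      (use c in \<open>simp add: coset_value_left[OF _ p q] coset_value_right[OF _ p] L_def U_def\<close>)
  also have "\<dots> = mark S q p"
    using sub_card_pos[OF L] by (simp add: mark_def U_def flip: sum_distrib_left)
  finally show ?thesis by (simp add: L_def U_def)
qed

lemma finite_double_cosets: "finite (double_cosets S U V)"
  using finite_carrier by (simp add: double_cosets_def)

text \<open>
  Unfolding restriction, projection and evaluation as linear extensions reduces the claim to basis
  elements, where it is \<open>restricted_class_value\<close> followed by \<open>sum_coset_values\<close>.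
\<close>
lemma species_eq_sum_marks:
  fixes q :: "('g, 'a, 'k::field_char_0) xpair"
  assumes q: "q \<in> xpairs S A" and x: "x \<in> fburnside S A"
  shows "species S q x = (\<Sum>c\<in>fclass S ` fpairs S A. x c * mark S q (pick c))"
proof -
  obtain L \<Phi> where [simp]: "q = (L, \<Phi>)" by fastforce
  have L: "subgroup L S" using q by (auto simp: xpairs_iff)
  let ?C = "fclass S ` fpairs S A"
  let ?D = "\<lambda>c. double_cosets S L (fst (pick c))"
  \<comment> \<open>\<open>k c D\<close> is the class contributed by the double coset \<open>D\<close> to the restriction of the class \<open>c\<close>.\<close>
  define k where "k c D = fclass (subgrp S L)
    (L \<inter> conj_set S (pick D) (fst (pick c)),
     restrict (conj_hom S (pick D) (fst (pick c)) (snd (pick c))) (L \<inter> conj_set S (pick D) (fst (pick c))))"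
    for c :: "('g, 'a) fpair set" and D
  define P :: "('g, 'a) fpair set \<Rightarrow> ('g \<Rightarrow> 'a) \<Rightarrow> 'k"
    where "P e = (case pick e of (U, \<phi>) \<Rightarrow> if U = L then basis_vec \<phi> else 0)" for e
  have res: "fb_res S L x = (\<Sum>c\<in>?C. scale (x c) (\<Sum>D\<in>?D c. basis_vec (k c D)))"
    unfolding fb_res_def lin_ext_fburnside[OF x] by (simp add: case_prod_beta k_def Let_def)
  have supp: "{e. (\<Sum>D\<in>?D c. basis_vec (k c D) :: _ \<Rightarrow> 'k) e \<noteq> 0} \<subseteq> k c ` ?D c" for c
    using support_sum_scale[of "?D c" "\<lambda>D. basis_vec (k c D)" "k c ` ?D c" "\<lambda>_. 1 :: 'k"]
    by (auto simp: support_basis_vec scale_def)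
  have P_eq: "(\<lambda>e. case pick e of (U, \<phi>) \<Rightarrow> if U = carrier (subgrp S L) then basis_vec \<phi> else 0) = P"
    by (simp add: P_def fun_eq_iff)
  have proj: "fb_proj (subgrp S L) (fb_res S L x) =
      (\<Sum>c\<in>?C. scale (x c) (\<Sum>D\<in>?D c. P (k c D)))"
  proof -
    have "fb_proj (subgrp S L) (fb_res S L x) =
        (\<Sum>c\<in>?C. scale (x c) (lin_ext P (\<Sum>D\<in>?D c. basis_vec (k c D))))"
      unfolding res fb_proj_def P_eq
    proof (rule lin_ext_sum_scale[of "\<Union>c\<in>?C. k c ` ?D c"])
      show "finite (\<Union>c\<in>?C. k c ` ?D c)"
        by (intro finite_UN_I finite_classes finite_imageI finite_double_cosets)
      show "{e. (\<Sum>D\<in>?D c. basis_vec (k c D) :: _ \<Rightarrow> 'k) e \<noteq> 0} \<subseteq> (\<Union>c\<in>?C. k c ` ?D c)"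
        if "c \<in> ?C" for c
        using supp[of c] that by (meson UN_upper order_trans)
    qed
    then show ?thesis by (simp add: lin_ext_sum_basis_vec finite_double_cosets)
  qed
  have finP: "finite {\<psi>. P e \<psi> \<noteq> 0}" for e
    by (rule finite_subset[of _ "{snd (pick e)}"])
      (auto simp: P_def basis_vec_def split: prod.splits if_splits)
  define Q where "Q = (\<Union>c\<in>?C. \<Union>D\<in>?D c. {\<psi>. P (k c D) \<psi> \<noteq> 0})"
  have finQ: "finite Q"
    unfolding Q_def by (intro finite_UN_I finite_classes finP finite_double_cosets)
  have suppP: "{\<psi>. (\<Sum>D\<in>?D c. P (k c D)) \<psi> \<noteq> 0} \<subseteq> Q" if "c \<in> ?C" for c
  proof -
    have "{\<psi>. P (k c D) \<psi> \<noteq> 0} \<subseteq> Q" if "D \<in> ?D c" for D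
      using that \<open>c \<in> ?C\<close> unfolding Q_def by blast
    then show ?thesis
      using support_sum_scale[of "?D c" "\<lambda>D. P (k c D)" Q "\<lambda>_. 1"] by (simp add: scale_def)
  qed
  have "species S q x = char_ext \<Phi> (\<Sum>c\<in>?C. scale (x c) (\<Sum>D\<in>?D c. P (k c D)))"
    by (simp add: species_def proj)
  also have "\<dots> = (\<Sum>c\<in>?C. x c * char_ext \<Phi> (\<Sum>D\<in>?D c. P (k c D)))"
    using finQ suppP by (rule char_ext_sum_scale)
  also have "\<dots> = (\<Sum>c\<in>?C. x c * mark S q (pick c))"
  proof (rule sum.cong[OF refl])
    fix c assume c: "c \<in> ?C"
    then have p: "pick c \<in> fpairs S A" by (rule pick_class_fpairs)
    have "char_ext \<Phi> (\<Sum>D\<in>?D c. P (k c D)) = (\<Sum>D\<in>?D c. char_ext \<Phi> (P (k c D)))"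
    proof -
      have "{\<psi>. P (k c D) \<psi> \<noteq> 0} \<subseteq> Q" if "D \<in> ?D c" for D
        using that c unfolding Q_def by blast
      then show ?thesis
        using char_ext_sum_scale[OF finQ, of "?D c" "\<lambda>D. P (k c D)" \<Phi> "\<lambda>_. 1"]
        by (simp add: scale_def)
    qed
    also have "\<dots> = (\<Sum>D\<in>?D c. coset_value S q (pick c) (pick D))"
    proof (rule sum.cong[OF refl])
      fix D assume D: "D \<in> ?D c"
      have "pick D \<in> carrier S"
        using p D L by (intro pick_double_coset(1)) (auto simp: fpairs_def)
      then show "char_ext \<Phi> (P (k c D)) = coset_value S q (pick c) (pick D)"
        using restricted_class_value[OF L, of "fst (pick c)" "snd (pick c)" "pick D" \<Phi>] p
        by (simp add: P_def k_def case_prod_beta char_ext_basis_vec char_ext_zero if_distrib[of "char_ext \<Phi>"] cong: if_cong)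
    qed
    also have "\<dots> = mark S q (pick c)" using sum_coset_values[OF q p] by simp
    finally show "x c * char_ext \<Phi> (\<Sum>D\<in>?D c. P (k c D)) = x c * mark S q (pick c)" by simp
  qed
  finally show ?thesis .
qed

lemma species_basis_vec:
  fixes q :: "('g, 'a, 'k::field_char_0) xpair"
  assumes q: "q \<in> xpairs S A" and p: "p \<in> fpairs S A"
  shows "species S q (basis_vec (fclass S p)) = mark S q p"
proof -
  have "species S q (basis_vec (fclass S p)) =
      (\<Sum>c\<in>fclass S ` fpairs S A. if c = fclass S p then mark S q (pick c) else 0)"
    unfolding species_eq_sum_marks[OF q basis_vec_fburnside[OF p]]
    by (rule sum.cong) (auto simp: basis_vec_def)
  also have "\<dots> = mark S q (pick (fclass S p))"
    using p by (simp add: finite_classes)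
  finally show ?thesis by (simp add: mark_pick[OF p])
qed

lemma species_sum_scale:
  fixes q :: "('g, 'a, 'k::field_char_0) xpair"
  assumes q: "q \<in> xpairs S A" and v: "\<And>i. i \<in> I \<Longrightarrow> v i \<in> fburnside S A"
  shows "species S q (\<Sum>i\<in>I. scale (a i) (v i)) = (\<Sum>i\<in>I. a i * species S q (v i))"
proof -
  let ?C = "fclass S ` fpairs S A"
  have "species S q (\<Sum>i\<in>I. scale (a i) (v i)) = (\<Sum>c\<in>?C. \<Sum>i\<in>I. a i * (v i c * mark S q (pick c)))"
    by (simp add: species_eq_sum_marks[OF q sum_scale_fburnside[OF v]] sum_fun_apply scale_apply
        sum_distrib_right mult.assoc)
  also have "\<dots> = (\<Sum>i\<in>I. a i * (\<Sum>c\<in>?C. v i c * mark S q (pick c)))"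
    by (subst sum.swap) (simp add: sum_distrib_left)
  also have "\<dots> = (\<Sum>i\<in>I. a i * species S q (v i))"
    by (intro sum.cong refl) (simp add: species_eq_sum_marks[OF q v])
  finally show ?thesis .
qed

end

section \<open>Species are multiplicative\<close>

context group
begin

lemma conj_set_Int:
  assumes "g \<in> carrier G" and "U \<subseteq> carrier G" and "V \<subseteq> carrier G"
  shows "conj_set G g (U \<inter> V) = conj_set G g U \<inter> conj_set G g V"
  using assms by (auto simp: mem_conj_set le_infI1)

end

context fibered_group
begin

lemma product_pair_fpairs:
  assumes p: "(U, \<phi>) \<in> fpairs S A" and p': "(V, \<psi>) \<in> fpairs S A" and g: "g \<in> carrier S"
    and W: "W = U \<inter> conj_set S g V"
  shows "(W, restrict \<phi> W \<otimes>\<^bsub>sub_dual S A W\<^esub> restrict (conj_hom S g V \<psi>) W) \<in> fpairs S A"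
proof -
  have U: "subgroup U S" "\<phi> \<in> carrier (sub_dual S A U)" using p by (auto simp: fpairs_iff)
  have V: "subgroup V S" "\<psi> \<in> carrier (sub_dual S A V)" using p' by (auto simp: fpairs_iff)
  have Ws: "subgroup W S"
    unfolding W using U(1) conj_set_subgroup[OF g V(1)] by (rule subgroups_Inter_pair)
  interpret dW: comm_group "sub_dual S A W" using Ws by (rule dual_comm_group)
  have "restrict \<phi> W \<in> carrier (sub_dual S A W)"
    by (rule restrict_sub_dual[OF U(2) Ws]) (simp add: W)
  moreover have "restrict (conj_hom S g V \<psi>) W \<in> carrier (sub_dual S A W)"
    by (rule restrict_sub_dual[OF conj_hom_dual[OF g V] Ws]) (simp add: W)
  ultimately show ?thesis using Ws by (simp add: fpairs_iff dW.m_closed)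
qed

text \<open>
  A subgroup \<open>L\<close> fixes \<open>h(U \<inter> gVg\<^sup>-\<^sup>1)\<close> exactly when it fixes both \<open>hU\<close> and \<open>hgV\<close>, and \<open>\<Phi>\<close> is
  multiplicative.
\<close>
lemma coset_value_product:
  assumes q: "q \<in> xpairs S A" and p: "(U, \<phi>) \<in> fpairs S A" and p': "(V, \<psi>) \<in> fpairs S A"
    and g: "g \<in> carrier S" and h: "h \<in> carrier S" and W: "W = U \<inter> conj_set S g V"
  shows "coset_value S q (W, restrict \<phi> W \<otimes>\<^bsub>sub_dual S A W\<^esub> restrict (conj_hom S g V \<psi>) W) h =
    coset_value S q (U, \<phi>) h * coset_value S q (V, \<psi>) (h \<otimes> g)"
proof -
  obtain L \<Phi> where [simp]: "q = (L, \<Phi>)" by fastforce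
  have L: "subgroup L S" and \<Phi>: "\<Phi> \<in> carrier (hom_group (sub_dual S A L) unit_group)"
    using q by (auto simp: xpairs_iff)
  have U: "subgroup U S" "\<phi> \<in> carrier (sub_dual S A U)" using p by (auto simp: fpairs_iff)
  have V: "subgroup V S" "\<psi> \<in> carrier (sub_dual S A V)" using p' by (auto simp: fpairs_iff)
  note sub = sub_subset[OF L] sub_subset[OF U(1)] sub_subset[OF V(1)]
  have gV: "conj_set S g V \<subseteq> carrier S" using g sub by (simp add: conj_set_subset)
  have hg: "h \<otimes> g \<in> carrier S" using g h by simp
  have hW: "conj_set S h W = conj_set S h U \<inter> conj_set S (h \<otimes> g) V"
    unfolding W using g h sub gV by (simp add: conj_set_Int conj_set_mult)
  show ?thesis
  proof (cases "L \<subseteq> conj_set S h W")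
    case True
    then have LU: "L \<subseteq> conj_set S h U" and LV: "L \<subseteq> conj_set S (h \<otimes> g) V" by (auto simp: hW)
    let ?\<alpha> = "restrict (conj_hom S h U \<phi>) L" and ?\<beta> = "restrict (conj_hom S (h \<otimes> g) V \<psi>) L"
    have \<alpha>: "?\<alpha> \<in> carrier (sub_dual S A L)"
      by (rule restrict_sub_dual[OF conj_hom_dual[OF h U] L LU])
    have \<beta>: "?\<beta> \<in> carrier (sub_dual S A L)"
      by (rule restrict_sub_dual[OF conj_hom_dual[OF hg V] L LV])
    have "restrict (conj_hom S h W
        (restrict \<phi> W \<otimes>\<^bsub>sub_dual S A W\<^esub> restrict (conj_hom S g V \<psi>) W)) L =
      ?\<alpha> \<otimes>\<^bsub>sub_dual S A L\<^esub> ?\<beta>"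
      unfolding mult_sub_dual
    proof (rule restrict_ext)
      fix x assume x: "x \<in> L"
      then have xW: "x \<in> conj_set S h W" using True by auto
      have xS: "x \<in> carrier S" using x sub by auto
      have W_sub: "W \<subseteq> carrier S" using sub by (auto simp: W)
      have y: "inv h \<otimes> x \<otimes> h \<in> W" using xW mem_conj_set[OF h W_sub] by simp
      then have yV: "inv h \<otimes> x \<otimes> h \<in> conj_set S g V" by (simp add: W)
      have eq: "inv g \<otimes> (inv h \<otimes> x \<otimes> h) \<otimes> g = inv (h \<otimes> g) \<otimes> x \<otimes> (h \<otimes> g)"
        using g h xS by (simp add: inv_mult_group m_assoc)
      show "conj_hom S h W (\<lambda>x\<in>W. restrict \<phi> W x \<otimes>\<^bsub>A\<^esub> restrict (conj_hom S g V \<psi>) W x) x =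
          ?\<alpha> x \<otimes>\<^bsub>A\<^esub> ?\<beta> x"
        using x xW y yV LU LV by (simp add: conj_hom_def eq subset_iff)
    qed
    then show ?thesis
      using True LU LV \<Phi> \<alpha> \<beta> by (simp add: coset_value_def mem_characters)
  next
    case False
    then show ?thesis by (auto simp: coset_value_def hW)
  qed
qed

lemma fb_mult_pair_fburnside:
  assumes p: "p \<in> fpairs S A" and p': "p' \<in> fpairs S A"
  shows "fb_mult_pair S A p p' \<in> fburnside S A"
proof -
  obtain U \<phi> where [simp]: "p = (U, \<phi>)" by fastforce
  obtain V \<psi> where [simp]: "p' = (V, \<psi>)" by fastforce
  have UV: "subgroup U S" "subgroup V S" using p p' by (auto simp: fpairs_iff)
  have "fb_mult_pair S A p p' = (\<Sum>D\<in>double_cosets S U V. scale 1 (basis_vec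
      (let g = pick D; W = U \<inter> conj_set S g V in
        fclass S (W, restrict \<phi> W \<otimes>\<^bsub>sub_dual S A W\<^esub> restrict (conj_hom S g V \<psi>) W))))"
    by (simp add: fb_mult_pair_def Let_def scale_def)
  also have "\<dots> \<in> fburnside S A"
    using p p' pick_double_coset(1)[OF UV]
    by (intro sum_scale_fburnside) (auto simp: Let_def intro!: basis_vec_fburnside product_pair_fpairs)
  finally show ?thesis .
qed

text \<open>
  By \<open>coset_value_product\<close> the double coset formula becomes a sum over all \<open>g\<close> and \<open>h\<close> of a
  product of a value at \<open>h\<close> and a value at \<open>hg\<close>; substituting \<open>hg\<close> as a new variable factorizes it.
\<close>
lemma species_fb_mult_pair:
  fixes q :: "('g, 'a, 'k::field_char_0) xpair"
  assumes q: "q \<in> xpairs S A" and p: "p \<in> fpairs S A" and p': "p' \<in> fpairs S A"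
  shows "species S q (fb_mult_pair S A p p') = mark S q p * mark S q p'"
proof -
  define U \<phi> where "U = fst p" and "\<phi> = snd p"
  define V \<psi> where "V = fst p'" and "\<psi> = snd p'"
  have pU: "p = (U, \<phi>)" and pV: "p' = (V, \<psi>)" by (simp_all add: U_def \<phi>_def V_def \<psi>_def)
  have U: "subgroup U S" and V: "subgroup V S" using p p' by (auto simp: fpairs_iff pU pV)
  note c = subgroup.mem_carrier[OF U] subgroup.mem_carrier[OF V]
  define W where "W g = U \<inter> conj_set S g V" for g
  define r where "r g = (W g, restrict \<phi> (W g) \<otimes>\<^bsub>sub_dual S A (W g)\<^esub> restrict (conj_hom S g V \<psi>) (W g))" for g
  have r: "r g \<in> fpairs S A" if "g \<in> carrier S" for g
    unfolding r_def using p p' that by (intro product_pair_fpairs) (auto simp: W_def pU pV)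
  have cv: "coset_value S q (r g) h = coset_value S q p h * coset_value S q p' (h \<otimes> g)"
    if "g \<in> carrier S" "h \<in> carrier S" for g h
    unfolding r_def pU pV using p p' q that by (intro coset_value_product) (auto simp: W_def pU pV)
  define T where "T g = (\<Sum>h\<in>carrier S. coset_value S q p h * coset_value S q p' (h \<otimes> g))" for g
  have T: "T (u \<otimes> g \<otimes> v) = T g" if u: "u \<in> U" and g: "g \<in> carrier S" and v: "v \<in> V" for u g v
  proof -
    have uS: "u \<in> carrier S" "v \<in> carrier S" using u v c by auto
    have "T (u \<otimes> g \<otimes> v) =
        (\<Sum>h\<in>carrier S. coset_value S q p (h \<otimes> u) * coset_value S q p' ((h \<otimes> u) \<otimes> g))"
      unfolding T_def
    proof (rule sum.cong[OF refl])
      fix h assume h: "h \<in> carrier S"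
      have "coset_value S q p' (h \<otimes> (u \<otimes> g \<otimes> v)) = coset_value S q p' ((h \<otimes> u) \<otimes> g \<otimes> v)"
        using h uS g by (simp add: m_assoc)
      also have "\<dots> = coset_value S q p' ((h \<otimes> u) \<otimes> g)"
        using h uS g v by (intro coset_value_right[OF _ p']) (auto simp: V_def)
      finally have 1: "coset_value S q p' (h \<otimes> (u \<otimes> g \<otimes> v)) = coset_value S q p' ((h \<otimes> u) \<otimes> g)" .
      have "coset_value S q p (h \<otimes> u) = coset_value S q p h"
        using h u by (intro coset_value_right[OF _ p]) (auto simp: U_def)
      with 1 show "coset_value S q p h * coset_value S q p' (h \<otimes> (u \<otimes> g \<otimes> v)) =
          coset_value S q p (h \<otimes> u) * coset_value S q p' ((h \<otimes> u) \<otimes> g)" by simp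
    qed
    also have "\<dots> = T g"
      unfolding T_def by (rule sum_translate(1)[OF uS(1)])
    finally show ?thesis .
  qed
  let ?DC = "double_cosets S U V"
  have D: "pick D \<in> carrier S" if "D \<in> ?DC" for D
    using pick_double_coset(1)[OF U V that] .
  have "fb_mult_pair S A p p' = (\<Sum>D\<in>?DC. scale 1 (basis_vec (fclass S (r (pick D)))))"
    by (simp add: fb_mult_pair_def pU pV Let_def r_def W_def scale_def)
  then have "species S q (fb_mult_pair S A p p') = (\<Sum>D\<in>?DC. 1 * species S q (basis_vec (fclass S (r (pick D)))))"
    unfolding \<open>fb_mult_pair S A p p' = _\<close>
    by (simp only: species_sum_scale[OF q basis_vec_fburnside[OF r[OF D]]])
  also have "\<dots> = (\<Sum>D\<in>?DC. T (pick D) / of_nat (card (U \<inter> conj_set S (pick D) V)))"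
  proof (rule sum.cong[OF refl])
    fix D assume "D \<in> ?DC"
    then have "pick D \<in> carrier S" by (rule D)
    then show "1 * species S q (basis_vec (fclass S (r (pick D)))) =
        T (pick D) / of_nat (card (U \<inter> conj_set S (pick D) V))"
      by (simp add: species_basis_vec[OF q r] mark_def cv T_def) (simp add: r_def W_def)
  qed
  also have "\<dots> = (\<Sum>g\<in>carrier S. T g) / (of_nat (card U) * of_nat (card V))"
    by (rule sum_double_cosets[OF finite_carrier U V T])
  also have "(\<Sum>g\<in>carrier S. T g) =
      (\<Sum>h\<in>carrier S. coset_value S q p h * (\<Sum>g\<in>carrier S. coset_value S q p' (h \<otimes> g)))"
    unfolding T_def by (subst sum.swap) (simp add: sum_distrib_left)
  also have "\<dots> = (\<Sum>h\<in>carrier S. coset_value S q p h) * (\<Sum>g\<in>carrier S. coset_value S q p' g)"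
    by (simp add: sum_translate(2) sum_distrib_right)
  finally show ?thesis by (simp add: mark_def U_def V_def)
qed

lemma fb_mult_eq:
  assumes x: "x \<in> fburnside S A" and y: "y \<in> fburnside S A"
  shows "fb_mult S A x y = (\<Sum>c\<in>fclass S ` fpairs S A. scale (x c)
    (\<Sum>d\<in>fclass S ` fpairs S A. scale (y d) (fb_mult_pair S A (pick c) (pick d))))"
  by (simp add: fb_mult_def lin_ext_fburnside[OF x] lin_ext_fburnside[OF y])

lemma fb_mult_fburnside:
  assumes x: "x \<in> fburnside S A" and y: "y \<in> fburnside S A"
  shows "fb_mult S A x y \<in> fburnside S A"
  unfolding fb_mult_eq[OF assms]
  by (intro sum_scale_fburnside fb_mult_pair_fburnside pick_class_fpairs)

lemma species_fb_mult:
  fixes q :: "('g, 'a, 'k::field_char_0) xpair"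
  assumes q: "q \<in> xpairs S A" and x: "x \<in> fburnside S A" and y: "y \<in> fburnside S A"
  shows "species S q (fb_mult S A x y) = species S q x * species S q y"
proof -
  let ?C = "fclass S ` fpairs S A"
  have "species S q (fb_mult S A x y) =
      (\<Sum>c\<in>?C. x c * (\<Sum>d\<in>?C. y d * (mark S q (pick c) * mark S q (pick d))))"
    unfolding fb_mult_eq[OF x y]
    by (subst species_sum_scale[OF q])
      (auto intro!: sum_scale_fburnside fb_mult_pair_fburnside pick_class_fpairs sum.cong
        simp: species_sum_scale[OF q] fb_mult_pair_fburnside pick_class_fpairs species_fb_mult_pair[OF q])
  also have "\<dots> = (\<Sum>c\<in>?C. x c * mark S q (pick c)) * (\<Sum>d\<in>?C. y d * mark S q (pick d))"
    unfolding sum_distrib_right by (rule sum.cong[OF refl]) (simp add: sum_distrib_left mult_ac)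
  finally show ?thesis by (simp add: species_eq_sum_marks[OF q x] species_eq_sum_marks[OF q y])
qed

end

section \<open>Species separate the elements of the algebra\<close>

context fibered_group
begin

text \<open>
  If the subgroup \<open>U\<close> in \<open>p\<close> is not larger than \<open>L\<close>, then \<open>L\<close> can only fix \<open>aU\<close> by being equal to \<open>aUa\<^sup>-\<^sup>1\<close>.  Writing the
  value as a sum over \<open>L\<^sup>*\<close> exposes its dependence on \<open>\<Phi>\<close> as evaluation of an element of \<open>\<bbbK>L\<^sup>*\<close>.
\<close>
lemma coset_value_top:
  assumes q: "(L, \<Phi>) \<in> xpairs S A" and p: "p \<in> fpairs S A" and a: "a \<in> carrier S"
    and card: "card (fst p) \<le> card L"
  shows "coset_value S (L, \<Phi>) p a =
    (\<Sum>\<theta>\<in>carrier (sub_dual S A L). if conj_act S a p = (L, \<theta>) then \<Phi> \<theta> else 0)"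
proof -
  obtain V \<psi> where p_eq [simp]: "p = (V, \<psi>)" by fastforce
  have L: "subgroup L S" using q by (auto simp: xpairs_iff)
  have V: "subgroup V S" "\<psi> \<in> carrier (sub_dual S A V)" using p by (auto simp: fpairs_iff)
  have aV: "conj_set S a V = L" if "L \<subseteq> conj_set S a V"
  proof -
    have "card (conj_set S a V) \<le> card L" using card a V by (simp add: card_conj_set sub_subset)
    moreover have "finite (conj_set S a V)" using conj_set_subgroup[OF a V(1)] by (rule sub_finite)
    ultimately show ?thesis using that card_seteq by metis
  qed
  show ?thesis
  proof (cases "L \<subseteq> conj_set S a V")
    case True
    have dual: "conj_hom S a V \<psi> \<in> carrier (sub_dual S A L)"
      using conj_hom_dual[OF a V] aV[OF True] by simp
    then have "restrict (conj_hom S a V \<psi>) L = conj_hom S a V \<psi>"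
      by (simp add: mem_sub_dual extensional_restrict)
    then show ?thesis
      using aV[OF True] dual finite_dual[OF L]
      by (simp add: coset_value_def conj_act_def)
  next
    case False
    then have "conj_set S a V \<noteq> L" by auto
    then show ?thesis using False by (simp add: coset_value_def conj_act_def)
  qed
qed

text \<open>
  Take a class \<open>[U, \<phi>]\<close> in the support of \<open>x\<close> with \<open>|U|\<close> maximal.  By \<open>coset_value_top\<close> the species
  of \<open>(U, \<Phi>)\<close> at \<open>x\<close> is \<open>\<Phi>\<close> evaluated at an element of \<open>\<bbbK>U\<^sup>*\<close>, which vanishes because its values at
  all \<open>\<Phi>\<close> do.  Its coefficient at \<open>\<phi>\<close> is the coefficient of \<open>x\<close> at \<open>[U, \<phi>]\<close> times the order of the
  stabilizer of \<open>(U, \<phi>)\<close> over \<open>|U|\<close>, so \<open>x\<close> vanishes at \<open>[U, \<phi>]\<close>, a contradiction.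
\<close>
lemma species_injective:
  fixes x :: "('g, 'a) fpair set \<Rightarrow> 'k::field_char_0"
  assumes sep: "\<And>U. subgroup U S \<Longrightarrow> characters_separate TYPE('k) (sub_dual S A U)"
    and x: "x \<in> fburnside S A" and zero: "\<And>q. q \<in> xpairs S A \<Longrightarrow> species S q x = 0"
  shows "x = 0"
proof (rule ccontr)
  let ?C = "fclass S ` fpairs S A"
  assume "x \<noteq> 0"
  then obtain c where c: "x c \<noteq> 0" by (auto simp: fun_eq_iff)
  define supp where "supp = {c. x c \<noteq> 0}"
  have supp: "finite supp" "supp \<noteq> {}" "supp \<subseteq> ?C"
    using x c finite_subset[OF _ finite_classes] by (auto simp: supp_def fburnside_iff)
  let ?size = "\<lambda>c. card (fst (pick c))"
  have "Max (?size ` supp) \<in> ?size ` supp" using supp by (intro Max_in) auto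
  then obtain c0 where c0: "c0 \<in> supp" "Max (?size ` supp) = ?size c0" by auto
  have max: "?size c \<le> ?size c0" if "c \<in> supp" for c
    using supp that c0(2) Max_ge[of "?size ` supp" "?size c"] by simp
  obtain U \<phi> where pick0: "pick c0 = (U, \<phi>)" by fastforce
  have p0: "(U, \<phi>) \<in> fpairs S A" using pick_class_fpairs[of c0] c0 supp pick0 by auto
  then have U: "subgroup U S" and \<phi>: "\<phi> \<in> carrier (sub_dual S A U)" by (auto simp: fpairs_iff)
  define coef where "coef \<theta> = (\<Sum>c\<in>?C. \<Sum>a\<in>carrier S.
    if conj_act S a (pick c) = (U, \<theta>) then x c / of_nat (?size c) else 0)" for \<theta>
  have "(\<Sum>\<theta>\<in>carrier (sub_dual S A U). coef \<theta> * \<Phi> \<theta>) = 0"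
    if \<Phi>: "\<Phi> \<in> carrier (hom_group (sub_dual S A U) unit_group)" for \<Phi>
  proof -
    have q: "(U, \<Phi>) \<in> xpairs S A" using U \<Phi> by (simp add: xpairs_iff)
    have "(\<Sum>\<theta>\<in>carrier (sub_dual S A U). coef \<theta> * \<Phi> \<theta>) =
        (\<Sum>c\<in>?C. \<Sum>a\<in>carrier S. \<Sum>\<theta>\<in>carrier (sub_dual S A U).
          (if conj_act S a (pick c) = (U, \<theta>) then x c / of_nat (?size c) else 0) * \<Phi> \<theta>)"
      unfolding coef_def sum_distrib_right
      by (subst sum.swap, intro sum.cong refl, subst sum.swap) simp
    also have "\<dots> = (\<Sum>c\<in>?C. x c * mark S (U, \<Phi>) (pick c))"
    proof (rule sum.cong[OF refl])
      fix c assume c: "c \<in> ?C"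
      then have p: "pick c \<in> fpairs S A" by (rule pick_class_fpairs)
      show "(\<Sum>a\<in>carrier S. \<Sum>\<theta>\<in>carrier (sub_dual S A U).
          (if conj_act S a (pick c) = (U, \<theta>) then x c / of_nat (?size c) else 0) * \<Phi> \<theta>) =
        x c * mark S (U, \<Phi>) (pick c)"
      proof (cases "c \<in> supp")
        case True
        then have "?size c \<le> card U" using max pick0 by simp
        then have "coset_value S (U, \<Phi>) (pick c) a =
            (\<Sum>\<theta>\<in>carrier (sub_dual S A U). if conj_act S a (pick c) = (U, \<theta>) then \<Phi> \<theta> else 0)"
          if "a \<in> carrier S" for a
          using that by (intro coset_value_top[OF q p])
        then show ?thesis
          by (simp add: mark_def sum_divide_distrib sum_distrib_left)
            (intro sum.cong refl, auto simp: if_distrib)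
      qed (simp add: supp_def cong: if_cong)
    qed
    also have "\<dots> = 0" using zero[OF q] species_eq_sum_marks[OF q x] by simp
    finally show ?thesis .
  qed
  then have "coef \<phi> = 0"
    using sep[OF U] \<phi> unfolding characters_separate_def by blast
  moreover have "coef \<phi> = of_nat (card {a \<in> carrier S. conj_act S a (U, \<phi>) = (U, \<phi>)}) * (x c0 / of_nat (card U))"
  proof -
    have "(\<Sum>a\<in>carrier S. if conj_act S a (pick c) = (U, \<phi>) then x c / of_nat (?size c) else 0) =
        (if c = c0 then of_nat (card {a \<in> carrier S. conj_act S a (U, \<phi>) = (U, \<phi>)}) * (x c0 / of_nat (card U)) else 0)"
      if c: "c \<in> ?C" for c
    proof (cases "c = c0")
      case True
      then show ?thesis using finite_carrier by (simp add: pick0 sum.If_cases Int_def)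
    next
      case False
      have "conj_act S a (pick c) \<noteq> (U, \<phi>)" if a: "a \<in> carrier S" for a
      proof
        assume eq: "conj_act S a (pick c) = (U, \<phi>)"
        have "c = fclass S (pick c)" using fclass_pick[OF c] by simp
        also have "\<dots> = fclass S (pick c0)"
          using fclass_conj_act[OF a pick_class_fpairs[OF c]] by (simp add: eq pick0)
        also have "\<dots> = c0" using fclass_pick c0 supp by blast
        finally show False using False by simp
      qed
      then show ?thesis using False by simp
    qed
    then show ?thesis
      using c0 supp finite_classes by (simp add: coef_def subset_iff)
  qed
  moreover have "\<one> \<in> {a \<in> carrier S. conj_act S a (U, \<phi>) = (U, \<phi>)}"
    using conj_act_one[OF p0] by simp
  then have "card {a \<in> carrier S. conj_act S a (U, \<phi>) = (U, \<phi>)} \<noteq> 0"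
    using finite_carrier by (metis (no_types, lifting) card_0_eq empty_iff finite_subset mem_Collect_eq subsetI)
  moreover have "x c0 \<noteq> 0" "card U \<noteq> 0" using c0 sub_card_pos[OF U] by (auto simp: supp_def)
  ultimately show False by simp
qed

end

section \<open>Primitive idempotents\<close>

definition xconj ::
  "('g, 'x) monoid_scheme \<Rightarrow> ('a, 'y) monoid_scheme \<Rightarrow> ('g, 'a, 'k::field) xpair \<Rightarrow> ('g, 'a, 'k) xpair \<Rightarrow> bool"
  where
  "xconj S A p q \<longleftrightarrow> (\<exists>g\<in>carrier S. q = xact S A g p)"

context fibered_group
begin

lemma scale_fburnside:
  fixes x :: "('g, 'a) fpair set \<Rightarrow> 'k::field_char_0"
  assumes x: "x \<in> fburnside S A"
  shows "scale r x \<in> fburnside S A"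
    and "q \<in> xpairs S A \<Longrightarrow> species S q (scale r x) = r * species S q x"
  using sum_scale_fburnside[of "{()}" "\<lambda>_. x" "\<lambda>_. r"]
    species_sum_scale[of q "{()}" "\<lambda>_. x" "\<lambda>_. r"] x by simp_all

lemma diff_fburnside:
  fixes x y :: "('g, 'a) fpair set \<Rightarrow> 'k::field_char_0"
  assumes x: "x \<in> fburnside S A" and y: "y \<in> fburnside S A"
  shows "x - y \<in> fburnside S A"
    and "q \<in> xpairs S A \<Longrightarrow> species S q (x - y) = species S q x - species S q y"
proof -
  show mem: "x - y \<in> fburnside S A"
    unfolding fburnside_iff
  proof clarify
    fix c assume "(x - y) c \<noteq> 0"
    then have "x c \<noteq> 0 \<or> y c \<noteq> 0" by auto
    then show "c \<in> fclass S ` fpairs S A" using x y unfolding fburnside_iff by blast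
  qed
  show "species S q (x - y) = species S q x - species S q y" if q: "q \<in> xpairs S A"
    by (simp add: species_eq_sum_marks[OF q] mem x y algebra_simps flip: sum_subtractf)
qed

lemma finite_xpairs: "finite (xpairs S A :: ('g, 'a, 'k::field) xpair set)"
proof -
  have "xpairs S A = Sigma {U. subgroup U S} (\<lambda>U. carrier (hom_group (sub_dual S A U) (unit_group :: 'k monoid)))"
    by (auto simp: xpairs_def)
  moreover have "finite (carrier (hom_group (sub_dual S A U) (unit_group :: 'k monoid)))" if "subgroup U S" for U
    using finite_characters[OF _ finite_dual[OF that]] dual_comm_group[OF that] comm_group.axioms(2) by blast
  ultimately show ?thesis using finite_subgroups by auto
qed

lemma xact_inv_cancel:
  assumes "q \<in> xpairs S A" and "g \<in> carrier S"
  shows "xact S A (inv g) (xact S A g q) = q" and "xact S A g (xact S A (inv g) q) = q"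
  using assms xact_mult[of "inv g" g q] xact_mult[of g "inv g" q]
  by (simp_all add: xpairs_subset xpairs_subgroup xact_one)

lemma xact_eq_iff:
  assumes "p \<in> xpairs S A" and "q \<in> xpairs S A" and "g \<in> carrier S"
  shows "xact S A (inv g) q = p \<longleftrightarrow> q = xact S A g p"
  using assms by (auto simp: xact_inv_cancel)

lemma xact_xact:
  assumes "p \<in> xpairs S A" and "g \<in> carrier S" and "h \<in> carrier S"
  shows "xact S A g (xact S A h p) = xact S A (g \<otimes> h) p"
  using assms by (simp add: xact_mult xpairs_subset xpairs_subgroup)

lemma xconj_refl: "p \<in> xpairs S A \<Longrightarrow> xconj S A p p"
  unfolding xconj_def by (rule bexI[of _ \<one>]) (simp_all add: xact_one)

lemma xconj_sym:
  assumes "p \<in> xpairs S A" and "xconj S A p q"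
  shows "xconj S A q p"
  using assms unfolding xconj_def by (metis inv_closed xact_inv_cancel(1))

lemma xconj_trans:
  assumes "p \<in> xpairs S A" and "xconj S A p q" and "xconj S A q r"
  shows "xconj S A p r"
  using assms unfolding xconj_def by (metis m_closed xact_xact)

lemma xconj_card: "p \<in> xpairs S A \<Longrightarrow> xconj S A p q \<Longrightarrow> card (fst q) = card (fst p)"
  by (auto simp: xconj_def fst_xact card_conj_set xpairs_subset)

lemma xconj_xpairs: "p \<in> xpairs S A \<Longrightarrow> xconj S A p q \<Longrightarrow> q \<in> xpairs S A"
  by (auto simp: xconj_def xact_xpairs)

lemma species_xconj:
  fixes p :: "('g, 'a, 'k::field_char_0) xpair"
  assumes p: "p \<in> xpairs S A" and "xconj S A p q" and x: "x \<in> fburnside S A"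
  shows "species S q x = species S p x"
proof -
  obtain g where g: "g \<in> carrier S" "q = xact S A g p" using assms by (auto simp: xconj_def)
  then show ?thesis
    using p x pick_class_fpairs by (simp add: species_eq_sum_marks xact_xpairs mark_xact)
qed

lemma card_transporter:
  assumes p: "p \<in> xpairs S A" and q: "q \<in> xpairs S A"
  shows "card {a \<in> carrier S. xact S A a p = q} = (if xconj S A p q then card (xstab S A p) else 0)"
proof (cases "xconj S A p q")
  case True
  then obtain g where g: "g \<in> carrier S" "q = xact S A g p" by (auto simp: xconj_def)
  have "bij_betw (\<lambda>a. g \<otimes> a) (xstab S A p) {a \<in> carrier S. xact S A a p = q}"
    by (rule bij_betw_byWitness[where f' = "\<lambda>a. inv g \<otimes> a"])
      (use g p in \<open>auto simp: xstab_def xact_inv_cancel simp flip: xact_xact\<close>)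
  then show ?thesis using True bij_betw_same_card by fastforce
next
  case False
  then have "{a \<in> carrier S. xact S A a p = q} = {}" by (auto simp: xconj_def)
  then show ?thesis using False by (metis card.empty)
qed

lemma xstab_card_nonzero:
  assumes "p \<in> xpairs S A"
  shows "card (xstab S A p) \<noteq> 0"
proof -
  have "\<one> \<in> xstab S A p" using xact_one[OF assms] by (simp add: xstab_def)
  moreover have "finite (xstab S A p)" using finite_carrier by (simp add: xstab_def)
  ultimately show ?thesis by auto
qed

text \<open>
  Up to normalization, the coefficients are those of the primitive idempotent of \<open>\<bbbK>L\<^sup>*\<close> belonging
  to the character \<open>\<Phi>\<close>, where \<open>p = (L, \<Phi>)\<close>.
\<close>
definition dual_sum :: "('g, 'a, 'k::field) xpair \<Rightarrow> ('g, 'a) fpair set \<Rightarrow> 'k" where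
  "dual_sum p = (\<Sum>\<phi>\<in>carrier (sub_dual S A (fst p)).
    scale (inverse (snd p \<phi>)) (basis_vec (fclass S (fst p, \<phi>))))"

lemma dual_sum_fburnside: "p \<in> xpairs S A \<Longrightarrow> dual_sum p \<in> fburnside S A"
  unfolding dual_sum_def
  by (intro sum_scale_fburnside basis_vec_fburnside) (simp add: fpairs_iff xpairs_subgroup)

text \<open>
  Orthogonality of characters makes these sums triangular: among the pairs whose subgroup is at
  least as large as that of \<open>p\<close>, only the conjugates of \<open>p\<close> have a nonzero species at
  \<open>dual_sum p\<close>.  The value is the same for all conjugates.
\<close>
lemma species_dual_sum:
  fixes p q :: "('g, 'a, 'k::field_char_0) xpair"
  assumes p: "p \<in> xpairs S A" and q: "q \<in> xpairs S A" and card: "card (fst p) \<le> card (fst q)"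
  shows "species S q (dual_sum p) =
    (if xconj S A p q then of_nat (card (carrier (sub_dual S A (fst p))) * card (xstab S A p)) / of_nat (card (fst p)) else 0)"
proof -
  obtain L \<Phi> where p_eq: "p = (L, \<Phi>)" by fastforce
  have L: "subgroup L S" and \<Phi>: "\<Phi> \<in> carrier (hom_group (sub_dual S A L) unit_group)"
    using p by (auto simp: xpairs_iff p_eq)
  interpret dL: comm_group "sub_dual S A L" using L by (rule dual_comm_group)
  let ?D = "carrier (sub_dual S A L)"
  have inner: "(\<Sum>\<phi>\<in>?D. inverse (\<Phi> \<phi>) * coset_value S q (L, \<phi>) a) =
      (if xact S A a p = q then of_nat (card ?D) else 0)" if a: "a \<in> carrier S" for a
  proof -
    \<comment> \<open>Moving \<open>a\<close> from \<open>(L, \<phi>)\<close> to \<open>q\<close> leaves the coset of the identity, so that \<open>\<phi>\<close> stays unconjugated.\<close>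
    define r where "r = xact S A (inv a) q"
    have r: "r \<in> xpairs S A" using a q by (simp add: r_def xact_xpairs)
    obtain M \<Theta> where r_eq: "r = (M, \<Theta>)" by fastforce
    have M: "subgroup M S" and \<Theta>: "\<Theta> \<in> carrier (hom_group (sub_dual S A M) unit_group)"
      using r by (auto simp: xpairs_iff r_eq)
    have "M = conj_set S (inv a) (fst q)" using r_eq by (metis fst_conv fst_xact r_def)
    then have cardM: "card L \<le> card M"
      using card a q by (simp add: p_eq card_conj_set xpairs_subset)
    have rp: "xact S A a p = q \<longleftrightarrow> r = p"
      using xact_eq_iff[OF p q a] unfolding r_def by auto
    have cv: "coset_value S q (L, \<phi>) a = (if M = L then \<Theta> \<phi> else 0)" if \<phi>: "\<phi> \<in> ?D" for \<phi>
    proof -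
      have f: "(L, \<phi>) \<in> fpairs S A" using L \<phi> by (simp add: fpairs_iff)
      have "coset_value S q (L, \<phi>) a = coset_value S r (L, \<phi>) \<one>"
        using coset_value_xact[of \<one> "inv a" "(L, \<phi>)" q] a f q by (simp add: r_def)
      also have "\<dots> = (\<Sum>\<theta>\<in>carrier (sub_dual S A M). if (L, \<phi>) = (M, \<theta>) then \<Theta> \<theta> else 0)"
        using coset_value_top[of M \<Theta> "(L, \<phi>)" \<one>] r f cardM conj_act_one[OF f] by (simp add: r_eq)
      also have "\<dots> = (if M = L then \<Theta> \<phi> else 0)"
        using \<phi> finite_dual[OF L] by (cases "M = L") auto
      finally show ?thesis .
    qed
    show ?thesis
    proof (cases "M = L")
      case True
      then have "(\<Sum>\<phi>\<in>?D. inverse (\<Phi> \<phi>) * coset_value S q (L, \<phi>) a) = (\<Sum>\<phi>\<in>?D. \<Theta> \<phi> / \<Phi> \<phi>)"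
        by (simp add: cv divide_inverse mult.commute)
      also have "\<dots> = (if \<Theta> = \<Phi> then of_nat (card ?D) else 0)"
        using \<Theta> \<Phi> True by (intro character_orthogonality) (auto intro: dL.group_axioms)
      finally show ?thesis using True rp by (simp add: r_eq p_eq)
    next
      case False
      then show ?thesis using rp by (simp add: cv r_eq p_eq)
    qed
  qed
  have "species S q (dual_sum p) = (\<Sum>\<phi>\<in>?D. inverse (\<Phi> \<phi>) * mark S q (L, \<phi>))"
    unfolding dual_sum_def using L
    by (subst species_sum_scale[OF q])
      (auto simp: p_eq fpairs_iff intro!: basis_vec_fburnside sum.cong simp: species_basis_vec[OF q])
  also have "\<dots> = (\<Sum>\<phi>\<in>?D. \<Sum>a\<in>carrier S. inverse (\<Phi> \<phi>) * coset_value S q (L, \<phi>) a) / of_nat (card L)"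
    by (simp add: mark_def sum_distrib_left sum_divide_distrib)
  also have "\<dots> = (\<Sum>a\<in>carrier S. if xact S A a p = q then of_nat (card ?D) else 0) / of_nat (card L)"
    by (subst sum.swap) (simp add: inner)
  also have "(\<Sum>a\<in>carrier S. if xact S A a p = q then of_nat (card ?D) else 0) =
      (of_nat (card {a \<in> carrier S. xact S A a p = q}) * of_nat (card ?D) :: 'k)"
    using finite_carrier by (simp add: sum.If_cases Int_def)
  finally show ?thesis
    using card_transporter[OF p q] by (simp add: p_eq mult.commute)
qed

text \<open>
  Normalizing \<open>dual_sum p\<close> gives the right species at all pairs whose subgroup is at least as large
  as that of \<open>p\<close>.  The species at smaller pairs are removed by subtracting multiples of the indicators
  of these pairs, which are available by induction on the order of the subgroup.
\<close>
lemma exists_species_indicator: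
  fixes p :: "('g, 'a, 'k::field_char_0) xpair"
  assumes "p \<in> xpairs S A"
  shows "\<exists>x\<in>fburnside S A. \<forall>q\<in>xpairs S A. species S q x = (if xconj S A p q then 1 else 0)"
  using assms
proof (induction "card (fst p)" arbitrary: p rule: less_induct)
  case less
  note p = less.prems
  define X where "X = {r \<in> xpairs S A :: ('g, 'a, 'k) xpair set. card (fst r) < card (fst p)}"
  have finX: "finite X" by (rule rev_finite_subset[OF finite_xpairs]) (auto simp: X_def)
  have "\<forall>r\<in>X. \<exists>x\<in>fburnside S A. \<forall>q\<in>xpairs S A. species S q x = (if xconj S A r q then 1 else 0)"
    using less.hyps by (auto simp: X_def)
  then obtain e where e: "\<And>r. r \<in> X \<Longrightarrow> e r \<in> fburnside S A"
    and e_species: "\<And>r q. r \<in> X \<Longrightarrow> q \<in> xpairs S A \<Longrightarrow> species S q (e r) = (if xconj S A r q then 1 else 0)"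
    by metis
  define orb where "orb r = {q \<in> xpairs S A. xconj S A r q}" for r :: "('g, 'a, 'k) xpair"
  define y where "y = dual_sum p"
  have y: "y \<in> fburnside S A" unfolding y_def using p by (rule dual_sum_fburnside)
  \<comment> \<open>Every pair of an orbit contributes the same indicator, hence the division by the orbit size.\<close>
  define z where "z = (\<Sum>r\<in>X. scale (species S r y / of_nat (card (orb r))) (e r))"
  have z: "z \<in> fburnside S A" unfolding z_def using e by (rule sum_scale_fburnside)
  define N :: 'k where
    "N = of_nat (card (carrier (sub_dual S A (fst p))) * card (xstab S A p)) / of_nat (card (fst p))"
  have "carrier (sub_dual S A (fst p)) \<noteq> {}"
    using monoid.one_closed[OF comm_monoid.axioms(1)[OF comm_group.axioms(1)[OF dual_comm_group[OF xpairs_subgroup[OF p]]]]]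
    by blast
  then have N: "N \<noteq> 0"
    using finite_dual[OF xpairs_subgroup[OF p]] xstab_card_nonzero[OF p] sub_card_pos[OF xpairs_subgroup[OF p]]
    by (simp add: N_def)
  have z_species: "species S q z = (if card (fst q) < card (fst p) then species S q y else 0)"
    if q: "q \<in> xpairs S A" for q
  proof -
    have "species S q z = (\<Sum>r\<in>X. species S r y / of_nat (card (orb r)) * (if xconj S A r q then 1 else 0))"
      unfolding z_def by (simp add: species_sum_scale[OF q e] e_species q)
    also have "\<dots> = (\<Sum>r\<in>X. if xconj S A r q then species S q y / of_nat (card (orb q)) else 0)"
    proof (rule sum.cong[OF refl])
      fix r assume "r \<in> X"
      then have r: "r \<in> xpairs S A" by (simp add: X_def)
      have "orb r = orb q" if rq: "xconj S A r q"
        unfolding orb_def using xconj_trans[OF q xconj_sym[OF r rq]] xconj_trans[OF r rq] by blast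
      then show "species S r y / of_nat (card (orb r)) * (if xconj S A r q then 1 else 0) =
          (if xconj S A r q then species S q y / of_nat (card (orb q)) else 0)"
        using species_xconj[OF r _ y, of q] by auto
    qed
    also have "\<dots> = of_nat (card {r \<in> X. xconj S A r q}) * (species S q y / of_nat (card (orb q)))"
      using finX by (simp add: sum.If_cases Int_def)
    also have "\<dots> = (if card (fst q) < card (fst p) then species S q y else 0)"
    proof (cases "card (fst q) < card (fst p)")
      case True
      have "{r \<in> X. xconj S A r q} = orb q"
      proof (rule Set.set_eqI)
        fix r show "r \<in> {r \<in> X. xconj S A r q} \<longleftrightarrow> r \<in> orb q"
          using True q xconj_sym[of r q] xconj_sym[of q r] xconj_card[of q r]
          by (auto simp: X_def orb_def)
      qed
      have "q \<in> orb q" using q xconj_refl by (simp add: orb_def)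
      moreover have "finite (orb q)"
        by (rule rev_finite_subset[OF finite_xpairs]) (auto simp: orb_def)
      ultimately have "card (orb q) \<noteq> 0" by auto
      with \<open>{r \<in> X. xconj S A r q} = orb q\<close> show ?thesis using True by simp
    next
      case False
      have "\<not> xconj S A r q" if "r \<in> X" for r
        using that False xconj_card[of r q] by (auto simp: X_def)
      then have "{r \<in> X. xconj S A r q} = {}" by blast
      then show ?thesis using False by (metis card.empty mult_zero_left of_nat_0)
    qed
    finally show ?thesis .
  qed
  have "species S q (scale (inverse N) (y - z)) = (if xconj S A p q then 1 else 0)"
    if q: "q \<in> xpairs S A" for q
  proof (cases "card (fst q) < card (fst p)")
    case True
    then have "\<not> xconj S A p q" using xconj_card[OF p, of q] by auto
    then show ?thesis using True q y z
      by (simp add: scale_fburnside diff_fburnside z_species)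
  next
    case False
    then have "species S q y = (if xconj S A p q then N else 0)"
      unfolding y_def N_def using p q by (intro species_dual_sum) auto
    then show ?thesis using False q y z N
      by (simp add: scale_fburnside diff_fburnside z_species)
  qed
  then show ?case using scale_fburnside(1)[OF diff_fburnside(1)[OF y z]] by blast
qed

lemma fburnside_eqI:
  fixes x y :: "('g, 'a) fpair set \<Rightarrow> 'k::field_char_0"
  assumes sep: "\<And>U. subgroup U S \<Longrightarrow> characters_separate TYPE('k) (sub_dual S A U)"
    and x: "x \<in> fburnside S A" and y: "y \<in> fburnside S A"
    and eq: "\<And>q. q \<in> xpairs S A \<Longrightarrow> species S q x = species S q y"
  shows "x = y"
proof -
  have "x - y = 0"
    by (rule species_injective[OF sep diff_fburnside(1)[OF x y]])
      (simp_all add: diff_fburnside(2)[OF x y] eq)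
  then show ?thesis by simp
qed

text \<open>
  An element whose species are all \<open>0\<close> or \<open>1\<close> is idempotent because species are multiplicative and
  separate elements; the latter also gives the uniqueness demanded by the definite description.
\<close>
lemma idem_characterization:
  fixes p :: "('g, 'a, 'k::field_char_0) xpair"
  assumes sep: "\<And>U. subgroup U S \<Longrightarrow> characters_separate TYPE('k) (sub_dual S A U)"
    and p: "p \<in> xpairs S A"
  shows "idem S A p \<in> fburnside S A"
    and "q \<in> xpairs S A \<Longrightarrow> species S q (idem S A p) = (if xconj S A p q then 1 else 0)"
proof -
  obtain x where x: "x \<in> fburnside S A"
    and sx: "\<And>q. q \<in> xpairs S A \<Longrightarrow> species S q x = (if xconj S A p q then 1 else 0)"
    using exists_species_indicator[OF p] by blast
  have "fb_mult S A x x = x"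
    by (rule fburnside_eqI[OF sep fb_mult_fburnside[OF x x] x]) (simp_all add: species_fb_mult[OF _ x x] sx)
  then have "idem S A p = x"
    unfolding idem_def xconj_def[symmetric]
    by (intro the_equality conjI ballI x) (auto simp: sx intro!: fburnside_eqI[OF sep _ x])
  then show "idem S A p \<in> fburnside S A"
    and "q \<in> xpairs S A \<Longrightarrow> species S q (idem S A p) = (if xconj S A p q then 1 else 0)"
    using x sx by simp_all
qed

end

section \<open>Induction\<close>

context fibered_group
begin

lemma fpairs_subgrp:
  assumes H: "subgroup H S" and p: "p \<in> fpairs (subgrp S H) A"
  shows "p \<in> fpairs S A" and "fst p \<subseteq> H"
proof -
  have "subgroup (fst p) (subgrp S H)" using p by (auto simp: fpairs_def)
  then show "p \<in> fpairs S A" "fst p \<subseteq> H"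
    using p incl_subgroup[OF H] subgroup.subset[of "fst p" "subgrp S H"] by (auto simp: fpairs_def)
qed

lemma xpairs_subgrp:
  assumes H: "subgroup H S"
  shows "p \<in> xpairs (subgrp S H) A \<longleftrightarrow> p \<in> xpairs S A \<and> fst p \<subseteq> H"
  using incl_subgroup[OF H] subgroup_incl[OF _ H] subgroup.subset[of "fst p" "subgrp S H"]
  by (auto simp: xpairs_def)

text \<open>
  Every element of the group is \<open>th\<close> with \<open>h \<in> H\<close> in exactly \<open>|H|\<close> ways.  Conjugating \<open>q\<close> by \<open>t\<^sup>-\<^sup>1\<close>
  instead of translating by \<open>t\<close> leaves a value at \<open>h\<close>, which is computed inside \<open>H\<close>; it is zero
  unless the conjugated subgroup lies in \<open>H\<close>.
\<close>
lemma mark_restrict: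
  fixes q :: "('g, 'a, 'k::field_char_0) xpair"
  assumes H: "subgroup H S" and q: "q \<in> xpairs S A" and p: "p \<in> fpairs (subgrp S H) A"
  shows "mark S q p = (\<Sum>t\<in>carrier S. if xact S A (inv t) q \<in> xpairs (subgrp S H) A
    then mark (subgrp S H) (xact S A (inv t) q) p else 0) / of_nat (card H)"
proof -
  note p' = fpairs_subgrp[OF H p]
  have HS: "h \<in> carrier S" if "h \<in> H" for h using subgroup.mem_carrier[OF H that] .
  have inner: "(\<Sum>h\<in>H. coset_value S q p (t \<otimes> h)) =
      (if xact S A (inv t) q \<in> xpairs (subgrp S H) A
       then \<Sum>h\<in>H. coset_value (subgrp S H) (xact S A (inv t) q) p h else 0)"
    if t: "t \<in> carrier S" for t
  proof -
    define r where "r = xact S A (inv t) q"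
    have r: "r \<in> xpairs S A" using t q by (simp add: r_def xact_xpairs)
    have 1: "coset_value S q p (t \<otimes> h) = coset_value S r p h" if "h \<in> H" for h
      using coset_value_xact[OF HS[OF that] _ p'(1) q, of "inv t"] t by (simp add: r_def)
    have 2: "coset_value S r p h = (if fst r \<subseteq> H then coset_value (subgrp S H) r p h else 0)"
      if h: "h \<in> H" for h
    proof -
      have "conj_set S h (fst p) \<subseteq> conj_set S h H" using p'(2) by (rule conj_set_mono)
      then have "conj_set S h (fst p) \<subseteq> H" using conj_set_self[OF H h] by simp
      moreover have "conj_set (subgrp S H) h (fst p) = conj_set S h (fst p)"
        "conj_hom (subgrp S H) h (fst p) (snd p) = conj_hom S h (fst p) (snd p)"
        using conj_act_subgrp(1,2)[OF H h] by (simp_all add: conj_act_def case_prod_beta)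
      ultimately show ?thesis by (auto simp: coset_value_def case_prod_beta)
    qed
    show ?thesis using r by (simp add: 1 2 xpairs_subgrp[OF H] flip: r_def)
  qed
  have "of_nat (card H) * (\<Sum>a\<in>carrier S. coset_value S q p a) =
      (\<Sum>h\<in>H. \<Sum>t\<in>carrier S. coset_value S q p (t \<otimes> h))"
    using HS by (simp add: sum_translate(1))
  also have "\<dots> = (\<Sum>t\<in>carrier S. \<Sum>h\<in>H. coset_value S q p (t \<otimes> h))"
    by (rule sum.swap)
  also have "\<dots> = (\<Sum>t\<in>carrier S. if xact S A (inv t) q \<in> xpairs (subgrp S H) A
       then \<Sum>h\<in>H. coset_value (subgrp S H) (xact S A (inv t) q) p h else 0)"
    by (simp add: inner)
  finally have "(\<Sum>a\<in>carrier S. coset_value S q p a) =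
      (\<Sum>t\<in>carrier S. if xact S A (inv t) q \<in> xpairs (subgrp S H) A
       then \<Sum>h\<in>H. coset_value (subgrp S H) (xact S A (inv t) q) p h else 0) / of_nat (card H)"
    using sub_card_pos[OF H] by (simp add: field_simps)
  then have "mark S q p = (\<Sum>t\<in>carrier S. (if xact S A (inv t) q \<in> xpairs (subgrp S H) A
       then \<Sum>h\<in>H. coset_value (subgrp S H) (xact S A (inv t) q) p h else 0) / of_nat (card (fst p))) / of_nat (card H)"
    by (simp add: mark_def sum_divide_distrib mult.commute)
  also have "(\<Sum>t\<in>carrier S. (if xact S A (inv t) q \<in> xpairs (subgrp S H) A
       then \<Sum>h\<in>H. coset_value (subgrp S H) (xact S A (inv t) q) p h else 0) / of_nat (card (fst p))) =
    (\<Sum>t\<in>carrier S. if xact S A (inv t) q \<in> xpairs (subgrp S H) A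
    then mark (subgrp S H) (xact S A (inv t) q) p else 0)"
    by (intro sum.cong refl) (simp add: mark_def)
  finally show ?thesis .
qed

lemma fb_ind_eq:
  assumes H: "subgroup H S" and x: "x \<in> fburnside (subgrp S H) A"
  shows "fb_ind (subgrp S H) S x =
    (\<Sum>c\<in>fclass (subgrp S H) ` fpairs (subgrp S H) A. scale (x c) (basis_vec (fclass S (pick c))))"
  unfolding fb_ind_def
  by (rule fibered_group.lin_ext_fburnside[OF subgroup_fibered_group[OF H] x])

lemma pick_subgrp_class:
  assumes H: "subgroup H S" and c: "c \<in> fclass (subgrp S H) ` fpairs (subgrp S H) A"
  shows "pick c \<in> fpairs (subgrp S H) A"
  by (rule fibered_group.pick_class_fpairs[OF subgroup_fibered_group[OF H] c])

lemma fb_ind_fburnside: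
  assumes H: "subgroup H S" and x: "x \<in> fburnside (subgrp S H) A"
  shows "fb_ind (subgrp S H) S x \<in> fburnside S A"
  unfolding fb_ind_eq[OF assms]
  by (intro sum_scale_fburnside basis_vec_fburnside fpairs_subgrp(1)[OF H] pick_subgrp_class[OF H])

lemma species_fb_ind:
  fixes q :: "('g, 'a, 'k::field_char_0) xpair"
  assumes H: "subgroup H S" and x: "x \<in> fburnside (subgrp S H) A" and q: "q \<in> xpairs S A"
  shows "species S q (fb_ind (subgrp S H) S x) =
    (\<Sum>t\<in>carrier S. if xact S A (inv t) q \<in> xpairs (subgrp S H) A
      then species (subgrp S H) (xact S A (inv t) q) x else 0) / of_nat (card H)"
proof -
  interpret H: fibered_group "subgrp S H" A using H by (rule subgroup_fibered_group)
  let ?C = "fclass (subgrp S H) ` fpairs (subgrp S H) A"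
  have "species S q (fb_ind (subgrp S H) S x) =
      (\<Sum>c\<in>?C. x c * species S q (basis_vec (fclass S (pick c))))"
    unfolding fb_ind_eq[OF H x]
    by (rule species_sum_scale[OF q]) (rule basis_vec_fburnside[OF fpairs_subgrp(1)[OF H pick_subgrp_class[OF H]]])
  also have "\<dots> = (\<Sum>c\<in>?C. \<Sum>t\<in>carrier S. if xact S A (inv t) q \<in> xpairs (subgrp S H) A
      then x c * mark (subgrp S H) (xact S A (inv t) q) (pick c) else 0) / of_nat (card H)"
    unfolding sum_divide_distrib[of _ ?C]
  proof (rule sum.cong[OF refl])
    fix c assume "c \<in> ?C"
    then have p: "pick c \<in> fpairs (subgrp S H) A" by (rule pick_subgrp_class[OF H])
    show "x c * species S q (basis_vec (fclass S (pick c))) =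
      (\<Sum>t\<in>carrier S. if xact S A (inv t) q \<in> xpairs (subgrp S H) A
      then x c * mark (subgrp S H) (xact S A (inv t) q) (pick c) else 0) / of_nat (card H)"
      unfolding species_basis_vec[OF q fpairs_subgrp(1)[OF H p]] mark_restrict[OF H q p]
      by (simp add: sum_distrib_left if_distrib cong: if_cong)
  qed
  also have "\<dots> = (\<Sum>t\<in>carrier S. if xact S A (inv t) q \<in> xpairs (subgrp S H) A
      then species (subgrp S H) (xact S A (inv t) q) x else 0) / of_nat (card H)"
    by (subst sum.swap, rule arg_cong[where f = "\<lambda>s. s / of_nat (card H)"], rule sum.cong[OF refl])
      (simp add: H.species_eq_sum_marks[OF _ x])
  finally show ?thesis .
qed

lemma xstab_subgroup:
  assumes p: "p \<in> xpairs S A"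
  shows "subgroup (xstab S A p) S"
proof (rule subgroupI)
  show "xstab S A p \<noteq> {}" using xact_one[OF p] by (auto simp: xstab_def)
  show "inv a \<in> xstab S A p" if "a \<in> xstab S A p" for a
    using that xact_inv_cancel(1)[OF p, of a] by (auto simp: xstab_def)
  show "a \<otimes> b \<in> xstab S A p" if "a \<in> xstab S A p" "b \<in> xstab S A p" for a b
    using that xact_xact[OF p, of a b] by (auto simp: xstab_def)
qed (auto simp: xstab_def)

lemma xstab_subgrp:
  assumes H: "subgroup H S"
  shows "xstab (subgrp S H) A p = H \<inter> xstab S A p"
  using subgroup.mem_carrier[OF H] by (auto simp: xstab_def conj_act_subgrp(3)[OF H])

text \<open>
  The elements that carry \<open>p\<close> into its \<open>H\<close>-orbit form the product \<open>H N\<close>, where \<open>N\<close> is the stabilizer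
  of \<open>p\<close>; this is the double coset of the identity.
\<close>
lemma card_orbit_transporter:
  assumes H: "subgroup H S" and p: "p \<in> xpairs S A"
  shows "card {v \<in> carrier S. \<exists>h\<in>H. xact S A v p = xact S A h p} * card (xstab (subgrp S H) A p) =
    card H * card (xstab S A p)"
proof -
  have HS: "h \<in> carrier S" if "h \<in> H" for h using subgroup.mem_carrier[OF H that] .
  have "{v \<in> carrier S. \<exists>h\<in>H. xact S A v p = xact S A h p} = (H #> \<one>) <#> xstab S A p"
  proof (intro Set.set_eqI iffI)
    fix v assume "v \<in> {v \<in> carrier S. \<exists>h\<in>H. xact S A v p = xact S A h p}"
    then obtain h where v: "v \<in> carrier S" and h: "h \<in> H" and eq: "xact S A v p = xact S A h p" by auto
    have "xact S A (inv h \<otimes> v) p = p"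
      using v HS[OF h] p by (simp add: eq xact_inv_cancel flip: xact_xact)
    then have "inv h \<otimes> v \<in> xstab S A p" using v HS[OF h] by (simp add: xstab_def)
    moreover have "v = h \<otimes> \<one> \<otimes> (inv h \<otimes> v)" using v HS[OF h] by simp
    ultimately show "v \<in> (H #> \<one>) <#> xstab S A p" using h unfolding mem_double_coset by blast
  next
    fix v assume "v \<in> (H #> \<one>) <#> xstab S A p"
    then obtain h n where h: "h \<in> H" and n: "n \<in> xstab S A p" and v: "v = h \<otimes> \<one> \<otimes> n"
      unfolding mem_double_coset by blast
    have "xact S A v p = xact S A h p"
      using n HS[OF h] p by (simp add: v xstab_def flip: xact_xact)
    then show "v \<in> {v \<in> carrier S. \<exists>h\<in>H. xact S A v p = xact S A h p}"
      using h n HS[OF h] by (auto simp: v xstab_def)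
  qed
  then show ?thesis
    using card_double_coset[OF finite_carrier H xstab_subgroup[OF p] one_closed]
      subgroup.subset[OF xstab_subgroup[OF p]]
    by (simp add: xstab_subgrp[OF H] conj_set_one)
qed

lemma fb_ind_idem:
  fixes p :: "('g, 'a, 'k::field_char_0) xpair"
  assumes sep: "\<And>U. subgroup U S \<Longrightarrow> characters_separate TYPE('k) (sub_dual S A U)"
    and H: "subgroup H S" and pH: "p \<in> xpairs (subgrp S H) A"
  shows "fb_ind (subgrp S H) S (idem (subgrp S H) A p) =
    scale (of_nat (card (xstab S A p)) / of_nat (card (xstab (subgrp S H) A p))) (idem S A p)"
proof -
  interpret H: fibered_group "subgrp S H" A using H by (rule subgroup_fibered_group)
  have HS: "h \<in> carrier S" if "h \<in> H" for h using subgroup.mem_carrier[OF H that] .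
  have p: "p \<in> xpairs S A" using pH xpairs_subgrp[OF H] by blast
  have sepH: "characters_separate TYPE('k) (sub_dual (subgrp S H) A U)" if "subgroup U (subgrp S H)" for U
    using sep[OF incl_subgroup[OF H that]] by simp
  have eH: "idem (subgrp S H) A p \<in> fburnside (subgrp S H) A"
    by (rule H.idem_characterization(1)[OF sepH pH])
  have species_eH: "species (subgrp S H) q (idem (subgrp S H) A p) = (if xconj (subgrp S H) A p q then 1 else 0)"
    if "q \<in> xpairs (subgrp S H) A" for q
    by (rule H.idem_characterization(2)[OF sepH pH that])
  have eS: "idem S A p \<in> fburnside S A"
    by (rule idem_characterization(1)[OF sep p])
  have species_eS: "species S q (idem S A p) = (if xconj S A p q then 1 else 0)"
    if "q \<in> xpairs S A" for q
    by (rule idem_characterization(2)[OF sep p that])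
  define r :: 'k where "r = of_nat (card (xstab S A p)) / of_nat (card (xstab (subgrp S H) A p))"
  have "species S q (fb_ind (subgrp S H) S (idem (subgrp S H) A p)) = species S q (scale r (idem S A p))"
    if q: "q \<in> xpairs S A" for q
  proof -
    let ?T = "{t \<in> carrier S. \<exists>h\<in>H. xact S A (inv t) q = xact S A h p}"
    have "(if xact S A (inv t) q \<in> xpairs (subgrp S H) A
        then species (subgrp S H) (xact S A (inv t) q) (idem (subgrp S H) A p) else 0) =
      (if \<exists>h\<in>H. xact S A (inv t) q = xact S A h p then 1 else 0 :: 'k)" for t
      using H.xconj_xpairs[OF pH, of "xact S A (inv t) q"]
      by (auto simp: species_eH xconj_def conj_act_subgrp(3)[OF H])
    then have "species S q (fb_ind (subgrp S H) S (idem (subgrp S H) A p)) = of_nat (card ?T) / of_nat (card H)"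
      using finite_carrier by (simp add: species_fb_ind[OF H eH q] sum.If_cases Int_def)
    also have "\<dots> = (if xconj S A p q then r else 0)"
    proof (cases "xconj S A p q")
      case True
      then obtain g where g: "g \<in> carrier S" "q = xact S A g p" by (auto simp: xconj_def)
      have "bij_betw (\<lambda>t. inv t \<otimes> g) ?T {v \<in> carrier S. \<exists>h\<in>H. xact S A v p = xact S A h p}"
        by (rule bij_betw_byWitness[where f' = "\<lambda>v. g \<otimes> inv v"])
          (use g p in \<open>auto simp: inv_mult_group m_assoc xact_xact\<close>)
      then have "card ?T * card (xstab (subgrp S H) A p) = card H * card (xstab S A p)"
        using card_orbit_transporter[OF H p] by (simp add: bij_betw_same_card)
      then have "of_nat (card ?T) * of_nat (card (xstab (subgrp S H) A p)) =
          (of_nat (card H) * of_nat (card (xstab S A p)) :: 'k)"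
        unfolding of_nat_mult[symmetric] by (rule arg_cong)
      then show ?thesis
        using True H.xstab_card_nonzero[OF pH] sub_card_pos[OF H] by (simp add: r_def field_simps)
    next
      case False
      have "?T = {}"
      proof (rule ccontr)
        assume "?T \<noteq> {}"
        then obtain t h where t: "t \<in> carrier S" and h: "h \<in> H" and eq: "xact S A (inv t) q = xact S A h p" by auto
        have "q = xact S A (t \<otimes> h) p"
          using xact_inv_cancel(2)[OF q t] t HS[OF h] p by (simp add: eq xact_xact)
        then show False using False t HS[OF h] unfolding xconj_def by blast
      qed
      then show ?thesis using False by (metis card.empty div_0 of_nat_0)
    qed
    also have "\<dots> = species S q (scale r (idem S A p))"
      by (simp add: scale_fburnside(2)[OF eS q] species_eS[OF q])
    finally show ?thesis .
  qed
  then have "fb_ind (subgrp S H) S (idem (subgrp S H) A p) = scale r (idem S A p)"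
    by (intro fburnside_eqI[OF sep fb_ind_fburnside[OF H eH]] scale_fburnside(1)[OF eS])
  then show ?thesis by (simp add: r_def)
qed

end

section \<open>Transfer from subquotients to subgroups\<close>

text \<open>
  The hypotheses of the theorem concern duals of subquotients, whose elements are cosets.  The
  quotient of \<open>U\<close> by the trivial subgroup is \<open>U\<close> in this guise, and its dual maps onto \<open>U\<^sup>*\<close>.
\<close>
lemma (in group) trivial_quotient_dual:
  assumes U: "subgroup U G"
  defines "Q \<equiv> subgrp G U Mod {\<one>}"
  defines "f \<equiv> \<lambda>\<phi>. \<lambda>x\<in>U. \<phi> {x}"
  shows "subquotient_of Q G" and "group Q"
    and "f \<in> hom (hom_group Q A) (sub_dual G A U)"
    and "f ` carrier (hom_group Q A) = carrier (sub_dual G A U)"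
proof -
  interpret U: group "subgrp G U" using U by (rule subgroup_imp_group)
  have US: "x \<in> carrier G" if "x \<in> U" for x using subgroup.mem_carrier[OF U that] .
  have normal: "{\<one>} \<lhd> subgrp G U" using U.one_is_normal by simp
  then show "subquotient_of Q G" using U by (auto simp: subquotient_of_def Q_def)
  show "group Q" unfolding Q_def by (rule normal.factorgroup_is_group[OF normal])
  have car: "carrier Q = (\<lambda>x. {x}) ` U"
    using US by (auto simp: Q_def FactGroup_def RCOSETS_def r_coset_def)
  have mult: "{x} \<otimes>\<^bsub>Q\<^esub> {y} = {x \<otimes> y}" for x y
    by (simp add: Q_def FactGroup_def set_mult_def)
  show "f \<in> hom (hom_group Q A) (sub_dual G A U)"
  proof (rule homI)
    show "f \<phi> \<in> carrier (sub_dual G A U)" if "\<phi> \<in> carrier (hom_group Q A)" for \<phi>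
      using that subgroup.m_closed[OF U] unfolding mem_sub_dual
      by (auto simp: f_def hom_group_def hom_def car simp flip: mult)
    show "f (\<phi> \<otimes>\<^bsub>hom_group Q A\<^esub> \<psi>) = f \<phi> \<otimes>\<^bsub>sub_dual G A U\<^esub> f \<psi>" for \<phi> \<psi>
      unfolding mult_sub_dual by (auto simp: f_def hom_group_def car intro!: restrict_ext)
  qed
  then have "f ` carrier (hom_group Q A) \<subseteq> carrier (sub_dual G A U)"
    by (auto simp: hom_def)
  moreover have "\<psi> \<in> f ` carrier (hom_group Q A)" if \<psi>: "\<psi> \<in> carrier (sub_dual G A U)" for \<psi>
  proof
    let ?\<phi> = "\<lambda>X\<in>carrier Q. \<psi> (the_elem X)"
    show "\<psi> = f ?\<phi>"
      using \<psi> unfolding mem_sub_dual by (auto simp: f_def car fun_eq_iff extensional_def)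
    show "?\<phi> \<in> carrier (hom_group Q A)"
      using \<psi> subgroup.m_closed[OF U] unfolding mem_sub_dual
      by (auto simp: hom_group_def hom_def car mult)
  qed
  ultimately show "f ` carrier (hom_group Q A) = carrier (sub_dual G A U)" by blast
qed

theorem proposition4p4:
  fixes G :: "('g, 'x) monoid_scheme" and A :: "('a, 'y) monoid_scheme"
    and H K :: "'g set" and \<Psi> :: "('g \<Rightarrow> 'a) \<Rightarrow> 'k::field_char_0"
  assumes "group G" and "finite (carrier G)" and "comm_group A"
    and "\<And>Q. subquotient_of Q G \<Longrightarrow> finite (carrier (hom_group Q A))"
    and "\<And>Q. subquotient_of Q G \<Longrightarrow> splitting_field TYPE('k) (hom_group Q A)"
    and "subgroup H G"
    and "(K, \<Psi>) \<in> xpairs (subgrp G H) A"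
  shows "fb_ind (subgrp G H) G (idem (subgrp G H) A (K, \<Psi>)) =
    scale (of_nat (card (xstab G A (K, \<Psi>))) / of_nat (card (xstab (subgrp G H) A (K, \<Psi>))))
      (idem G A (K, \<Psi>))"
proof -
  interpret group G by fact
  interpret A: comm_group A by fact
  have finite_dual: "finite (carrier (sub_dual G A U))" if "subgroup U G" for U
    using finite_imageI[OF assms(4)[OF trivial_quotient_dual(1)[OF that]]]
      trivial_quotient_dual(4)[OF that, of A] by metis
  interpret fibered_group G A
    by unfold_locales (rule assms(2), rule finite_dual)
  have "characters_separate TYPE('k) (sub_dual G A U)" if U: "subgroup U G" for U
  proof (rule splitting_field_imp_characters_separate[OF dual_comm_group[OF U] finite_dual[OF U]])
    note q = trivial_quotient_dual(1,2)[OF U] trivial_quotient_dual(3,4)[OF U, of A]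
    show "splitting_field TYPE('k) (sub_dual G A U)"
      using hom_group_comm_group[OF q(2) assms(3)] dual_comm_group[OF U]
      by (intro splitting_field_hom_image[OF q(3,4) _ _ assms(5)[OF q(1)]] comm_group.axioms(2))
  qed
  then show ?thesis using assms(6,7) by (rule fb_ind_idem)
qed

end
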